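(* Let $n\ge m\ge 1$ be integers, and let $G=(V,E)$ be a finite multigraph with $n$ vertices. Assume that $G$ has no isolated vertices. Then $$c_{(m,1^{n-m})}(G)=\sum_{\omega\in Z(G)}\binom{s(\omega)-1}{n-m},$$ where $Z(G)$ is the set of acyclic orientations of $G$ with a unique sink and $s(\omega)$ is the number of sources of $\omega$.
   Context: Multigraphs may have loops and parallel edges. A vertex is isolated if it has no incident edges. The chromatic symmetric function of $G=(V,E)$ is $X(G):=\sum_{\chi}\prod_{v\in V}x_{\chi(v)}\in\mathbb{Z}[[x_1,x_2,\ldots]]$, where $\chi$ ranges over all proper vertex colorings $\chi:V\to\{1,2,\ldots\}$, i.e. the two endpoints of each edge receive different colors (so $X(G)=0$ if $G$ has a loop). It is a homogeneous symmetric function of degree $|V|$. With $e_m:=\sum_{1\le i_1<\cdots<i_m}x_{i_1}\cdots x_{i_m}$ and $e_\lambda:=e_{\lambda_1}\cdots e_{\lambda_r}$ for an integer partition $\lambda=(\lambda_1,\ldots,\lambda_r)$, the $e_\lambda$ with $\lambda$ of size $n$ form a basis of the homogeneous symmetric functions of degree $n$, and $c_\lambda(G)$ denotes the coefficient of $e_\lambda$ in the expansion $X(G)=\sum_\lambda c_\lambda(G)e_\lambda$. The notation $(m,1^{n-m})$ denotes the partition with one part of size $m$ and $n-m$ further parts of size $1$. An orientation of a multigraph chooses a direction for each edge; it is acyclic if it has no directed cycle (so a multigraph with a loop has no acyclic orientations, and parallel edges must be oriented in the same direction). A sink is a vertex of out-degree $0$; a source is a vertex of in-degree $0$. The binomial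 coefficient $\binom{a}{b}$, for integers $a\ge 0$ and $b$, is $0$ when $b<0$ or $b>a$. *)

theory Defs
  imports Complex_Main "HOL-Library.Multiset" "HOL-Library.FuncSet"
begin

section \<open>Formal power series in countably many variables\<close>

text \<open>
  A monomial is a finite multiset of variable indices (the multiplicity of an index is its
  exponent), so multiplication of monomials is addition of multisets, and divisibility is
  \<open>\<subseteq>#\<close>. Indices start at 0: the natural number \<open>i\<close> stands for the variable
  \<open>x\<close> with subscript \<open>i + 1\<close>, and likewise for the colour \<open>i + 1\<close>.
\<close>

typedef 'a mpowser = "UNIV :: (nat multiset \<Rightarrow> 'a) set"
  morphisms mcoeff Abs_mpowser ..

lemma mcoeff_Abs [simp]: "mcoeff (Abs_mpowser f) = f"
  by (simp add: Abs_mpowser_inverse)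

lemma mpowser_eqI: "(\<And>M. mcoeff f M = mcoeff g M) \<Longrightarrow> f = g"
  by (metis ext mcoeff_inject)

lemma finite_submultisets: "finite {A. A \<subseteq># (M :: 'b multiset)}"
proof (induction M)
  case (add x M)
  have "{A. A \<subseteq># add_mset x M} \<subseteq> {A. A \<subseteq># M} \<union> add_mset x ` {A. A \<subseteq># M}"
  proof
    fix A assume "A \<in> {A. A \<subseteq># add_mset x M}"
    then have A: "A \<subseteq># add_mset x M" by simp
    show "A \<in> {A. A \<subseteq># M} \<union> add_mset x ` {A. A \<subseteq># M}"
    proof (cases "x \<in># A")
      case True
      then obtain B where "A = add_mset x B" by (metis insert_DiffM)
      then show ?thesis using A by auto
    next
      case False
      then have "A \<subseteq># M"
        using A unfolding subseteq_mset_def count_add_mset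
        by (metis not_in_iff zero_le)
      then show ?thesis by simp
    qed
  qed
  then show ?case using add finite_subset by blast
qed simp

instantiation mpowser :: (comm_ring_1) comm_ring_1
begin

definition zero_mpowser :: "'a mpowser" where
  "0 = Abs_mpowser (\<lambda>_. 0)"

definition one_mpowser :: "'a mpowser" where
  "1 = Abs_mpowser (\<lambda>M. if M = {#} then 1 else 0)"

definition plus_mpowser :: "'a mpowser \<Rightarrow> 'a mpowser \<Rightarrow> 'a mpowser" where
  "f + g = Abs_mpowser (\<lambda>M. mcoeff f M + mcoeff g M)"

definition uminus_mpowser :: "'a mpowser \<Rightarrow> 'a mpowser" where
  "- f = Abs_mpowser (\<lambda>M. - mcoeff f M)"

definition minus_mpowser :: "'a mpowser \<Rightarrow> 'a mpowser \<Rightarrow> 'a mpowser" where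
  "f - g = Abs_mpowser (\<lambda>M. mcoeff f M - mcoeff g M)"

definition times_mpowser :: "'a mpowser \<Rightarrow> 'a mpowser \<Rightarrow> 'a mpowser" where
  "f * g = Abs_mpowser (\<lambda>M. \<Sum>A | A \<subseteq># M. mcoeff f A * mcoeff g (M - A))"

lemma mcoeff_zero [simp]: "mcoeff (0 :: 'a mpowser) M = 0"
  and mcoeff_one: "mcoeff (1 :: 'a mpowser) M = (if M = {#} then 1 else 0)"
  and mcoeff_add [simp]: "mcoeff (f + g) M = mcoeff f M + mcoeff (g :: 'a mpowser) M"
  and mcoeff_uminus [simp]: "mcoeff (- f) M = - mcoeff (f :: 'a mpowser) M"
  and mcoeff_diff [simp]: "mcoeff (f - g) M = mcoeff f M - mcoeff (g :: 'a mpowser) M"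
  and mcoeff_mult:
    "mcoeff (f * g) M = (\<Sum>A | A \<subseteq># M. mcoeff f A * mcoeff (g :: 'a mpowser) (M - A))"
  by (simp_all add: zero_mpowser_def one_mpowser_def plus_mpowser_def uminus_mpowser_def
      minus_mpowser_def times_mpowser_def)

instance
proof
  fix f g h :: "'a mpowser"
  show "f * g * h = f * (g * h)"
  proof (rule mpowser_eqI)
    fix M
    have "mcoeff (f * g * h) M =
      (\<Sum>(A, B) \<in> (SIGMA A:{A. A \<subseteq># M}. {B. B \<subseteq># A}).
         mcoeff f B * mcoeff g (A - B) * mcoeff h (M - A))"
      by (simp add: mcoeff_mult sum_distrib_right sum.Sigma finite_submultisets)
    also have "\<dots> = (\<Sum>(A, B) \<in> (SIGMA A:{A. A \<subseteq># M}. {B. B \<subseteq># M - A}).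
         mcoeff f A * (mcoeff g B * mcoeff h (M - A - B)))"
      by (rule sum.reindex_bij_witness
            [where i = "\<lambda>(A, B). (A + B, A)" and j = "\<lambda>(A, B). (B, A - B)"])
        (auto simp: ac_simps subset_eq_diff_conv subset_mset.le_diff_conv2
          intro: subset_mset.order_trans)
    also have "\<dots> = mcoeff (f * (g * h)) M"
      by (simp add: mcoeff_mult sum_distrib_left sum.Sigma finite_submultisets)
    finally show "mcoeff (f * g * h) M = mcoeff (f * (g * h)) M" .
  qed
  show "f * g = g * f"
  proof (rule mpowser_eqI)
    fix M
    show "mcoeff (f * g) M = mcoeff (g * f) M"
      unfolding mcoeff_mult
      by (rule sum.reindex_bij_witness[where i = "\<lambda>A. M - A" and j = "\<lambda>A. M - A"])
        (auto simp: mult.commute subset_mset.diff_diff_right)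
  qed
  show "1 * f = f"
  proof (rule mpowser_eqI)
    fix M
    have "mcoeff (1 * f) M = (\<Sum>A\<in>{{#}}. mcoeff 1 A * mcoeff f (M - A))"
      unfolding mcoeff_mult
      by (rule sum.mono_neutral_right) (auto simp: mcoeff_one finite_submultisets)
    then show "mcoeff (1 * f) M = mcoeff f M" by (simp add: mcoeff_one)
  qed
  show "(f + g) * h = f * h + g * h"
    by (rule mpowser_eqI) (simp add: mcoeff_mult algebra_simps sum.distrib)
  show "(0 :: 'a mpowser) \<noteq> 1"
    by (metis mcoeff_one mcoeff_zero zero_neq_one)
qed (auto intro!: mpowser_eqI simp: algebra_simps)

end

definition mvar :: "nat \<Rightarrow> 'a::comm_ring_1 mpowser" where
  "mvar i = Abs_mpowser (\<lambda>M. if M = {#i#} then 1 else 0)"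

text \<open>
  The formal sum of a possibly infinite family, coefficient by coefficient. It is only meaningful
  if for every monomial only finitely many members of the family have a nonzero coefficient there,
  as is the case for both families it is used for below.
\<close>

definition formal_sum :: "'i set \<Rightarrow> ('i \<Rightarrow> 'a::comm_ring_1 mpowser) \<Rightarrow> 'a mpowser" where
  "formal_sum I f = Abs_mpowser (\<lambda>M. \<Sum>i | i \<in> I \<and> mcoeff (f i) M \<noteq> 0. mcoeff (f i) M)"


section \<open>Elementary symmetric functions\<close>

definition elem_sym :: "nat \<Rightarrow> int mpowser" where
  "elem_sym m = formal_sum {I. finite I \<and> card I = m} (\<lambda>I. \<Prod>i\<in>I. mvar i)"

text \<open>Integer partitions are represented as multisets of positive parts.\<close>

definition int_partitions :: "nat \<Rightarrow> nat multiset set" where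
  "int_partitions n = {p. 0 \<notin># p \<and> sum_mset p = n}"

definition elem_sym_part :: "nat multiset \<Rightarrow> int mpowser" where
  "elem_sym_part p = (\<Prod>k\<in>#p. elem_sym k)"

text \<open>
  The coefficients of a homogeneous symmetric function \<open>f\<close> of degree \<open>n\<close> in the basis of
  elementary symmetric functions. Requiring \<open>c\<close> to vanish off the partitions of \<open>n\<close> only
  serves to make \<open>c\<close> unique as a total function.
\<close>

definition elem_sym_coeff :: "nat \<Rightarrow> int mpowser \<Rightarrow> nat multiset \<Rightarrow> int" where
  "elem_sym_coeff n f = (THE c. (\<forall>p. p \<notin> int_partitions n \<longrightarrow> c p = 0) \<and>
     f = (\<Sum>p\<in>int_partitions n. of_int (c p) * elem_sym_part p))"


section \<open>Multigraphs\<close>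

text \<open>A loop at \<open>v\<close> is an edge \<open>e\<close> with \<open>ends G e = {v}\<close>.\<close>

record ('v, 'e) multigraph =
  verts :: "'v set"
  edges :: "'e set"
  ends :: "'e \<Rightarrow> 'v set"

definition finite_multigraph :: "('v, 'e) multigraph \<Rightarrow> bool" where
  "finite_multigraph G \<longleftrightarrow> finite (verts G) \<and> finite (edges G) \<and>
     (\<forall>e\<in>edges G. \<exists>u\<in>verts G. \<exists>v\<in>verts G. ends G e = {u, v})"

definition isolated :: "('v, 'e) multigraph \<Rightarrow> 'v \<Rightarrow> bool" where
  "isolated G v \<longleftrightarrow> v \<in> verts G \<and> (\<forall>e\<in>edges G. v \<notin> ends G e)"

text \<open>The case \<open>u = v\<close> is included on purpose: a multigraph with a loop has no proper colouring.\<close>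

definition proper_colorings :: "('v, 'e) multigraph \<Rightarrow> ('v \<Rightarrow> nat) set" where
  "proper_colorings G = {\<chi> \<in> verts G \<rightarrow>\<^sub>E UNIV.
     \<forall>e\<in>edges G. \<forall>u v. ends G e = {u, v} \<longrightarrow> \<chi> u \<noteq> \<chi> v}"

definition chromatic_sym :: "('v, 'e) multigraph \<Rightarrow> int mpowser" where
  "chromatic_sym G = formal_sum (proper_colorings G) (\<lambda>\<chi>. \<Prod>v\<in>verts G. mvar (\<chi> v))"

definition chromatic_coeff :: "('v, 'e) multigraph \<Rightarrow> nat multiset \<Rightarrow> int" where
  "chromatic_coeff G = elem_sym_coeff (card (verts G)) (chromatic_sym G)"


section \<open>Acyclic orientations\<close>

text \<open>
  An orientation sends every edge to its pair (tail, head). It is \<open>undefined\<close> off the edge set,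
  so that different orientations are different functions.
\<close>

definition orientations :: "('v, 'e) multigraph \<Rightarrow> ('e \<Rightarrow> 'v \<times> 'v) set" where
  "orientations G = {\<omega> \<in> edges G \<rightarrow>\<^sub>E verts G \<times> verts G.
     \<forall>e\<in>edges G. {fst (\<omega> e), snd (\<omega> e)} = ends G e}"

definition acyclic_orientations :: "('v, 'e) multigraph \<Rightarrow> ('e \<Rightarrow> 'v \<times> 'v) set" where
  "acyclic_orientations G = {\<omega> \<in> orientations G. acyclic (\<omega> ` edges G)}"

definition out_degree :: "('v, 'e) multigraph \<Rightarrow> ('e \<Rightarrow> 'v \<times> 'v) \<Rightarrow> 'v \<Rightarrow> nat" where
  "out_degree G \<omega> v = card {e \<in> edges G. fst (\<omega> e) = v}"

definition in_degree :: "('v, 'e) multigraph \<Rightarrow> ('e \<Rightarrow> 'v \<times> 'v) \<Rightarrow> 'v \<Rightarrow> nat" where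
  "in_degree G \<omega> v = card {e \<in> edges G. snd (\<omega> e) = v}"

definition sinks :: "('v, 'e) multigraph \<Rightarrow> ('e \<Rightarrow> 'v \<times> 'v) \<Rightarrow> 'v set" where
  "sinks G \<omega> = {v \<in> verts G. out_degree G \<omega> v = 0}"

definition sources :: "('v, 'e) multigraph \<Rightarrow> ('e \<Rightarrow> 'v \<times> 'v) \<Rightarrow> 'v set" where
  "sources G \<omega> = {v \<in> verts G. in_degree G \<omega> v = 0}"

definition unique_sink_orientations :: "('v, 'e) multigraph \<Rightarrow> ('e \<Rightarrow> 'v \<times> 'v) set" where
  "unique_sink_orientations G = {\<omega> \<in> acyclic_orientations G. \<exists>!v. v \<in> sinks G \<omega>}"

end

(*
Evaluating the e-expansion of the chromatic symmetric function at arbitrary values of the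
elementary symmetric functions gives a number P_G(e). Singling out one variable of value y, and
with it the colour class A of that colour, yields
  P_G(e_k + y e_{k-1}) = sum over stable sets A of y^|A| P_{G-A}(e).
For e_k = 1 and y = -1 this is the recursion satisfied by the number of acyclic orientations, since
the stable sets of sources of an acyclic orientation are all sets of its sources. With y = t - 1
instead one gets P_G(t, t, ...) = sum over acyclic orientations of t^(number of sinks), whose
linear coefficient identifies the coefficient of e_n with the number of unique-sink orientations.
For y = 1 and e_k = (-1)^(k-m) t (k >= m), e_k = 0 (0 < k < m), modulo t^2, one obtains the
coefficient of e_(m,1^(n-m)) as an alternating sum of numbers of unique-sink orientations of G - A.
In the absence of isolated vertices these correspond to unique-sink orientations of G in which
all vertices of A are sources, and the alternating sum over A collapses to a binomial coefficient.
*)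
theory Submission
  imports Defs "HOL-Computational_Algebra.Polynomial"
begin

text \<open>Evaluating at arbitrary ring elements in place of the e_k makes sense for two reasons:
  the e_k are algebraically independent, so values are unique, and X(G) is an integer polynomial in
  the e_k. Plain deletion-contraction cannot give the latter, because contraction lowers the degree.
  Vertices therefore carry weights; constraints are removed until only products of power sums
  remain, and Newton's recursion for hooks expresses these in the e_k without division.

  The values e_k = (-1)^(k-m) t for k >= m are chosen so that a further variable of value 1 leaves
  e_1 = 1 (coming from e_0 = 1), e_m = t, and makes all other e_k with k > 0 cancel. The linear
  coefficient in t then selects the partitions with parts 1 and m in which m occurs once. Before the
  variable is added, every e_k with k > 0 is a multiple of t, so each G - A contributes only its
  one-part coefficient. For m = 1 the values 1 and t would compete for e_1; there both sides are
  shown to be 0 separately.\<close>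

definition mmonom :: "nat multiset \<Rightarrow> 'a::comm_ring_1 mpowser" where
  "mmonom A = Abs_mpowser (\<lambda>M. if M = A then 1 else 0)"

lemma mcoeff_mmonom: "mcoeff (mmonom A) M = (if M = A then 1 else 0)"
  by (simp add: mmonom_def)

lemma mmonom_empty: "mmonom {#} = 1"
  by (rule mpowser_eqI) (simp add: mcoeff_mmonom mcoeff_one)

lemma mcoeff_mmonom_mult:
  "mcoeff (mmonom A * f) M = (if A \<subseteq># M then mcoeff f (M - A) else 0)"
proof -
  have "mcoeff (mmonom A * f) M = (\<Sum>B | B \<subseteq># M. if B = A then mcoeff f (M - B) else 0)"
    unfolding mcoeff_mult by (rule sum.cong) (auto simp: mcoeff_mmonom)
  also have "\<dots> = (if A \<subseteq># M then mcoeff f (M - A) else 0)"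
    by (subst sum.delta) (auto simp: finite_submultisets)
  finally show ?thesis .
qed

lemma mmonom_add: "mmonom (A + B) = mmonom A * mmonom B"
  by (rule mpowser_eqI)
    (auto simp: mcoeff_mmonom_mult mcoeff_mmonom subset_mset.le_iff_add)

text \<open>Reading coefficients at \<open>A + M\<close> recovers \<open>f\<close>. The independence
  proof uses this to divide by the product of all variables that are left.\<close>

lemma mmonom_mult_eq_0_iff: "mmonom A * f = 0 \<longleftrightarrow> f = 0"
proof
  assume *: "mmonom A * f = 0"
  show "f = 0"
  proof (rule mpowser_eqI)
    fix M
    have "mcoeff (mmonom A * f) (A + M) = mcoeff f M"
      by (simp add: mcoeff_mmonom_mult)
    then show "mcoeff f M = mcoeff 0 M" by (simp add: *)
  qed
qed simp

lemma prod_mvar: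
  assumes "finite V"
  shows "(\<Prod>v\<in>V. mvar (\<chi> v)) = (mmonom (image_mset \<chi> (mset_set V)) :: 'b::comm_ring_1 mpowser)"
  using assms
proof (induction V)
  case (insert v V)
  have "mvar (\<chi> v) = (mmonom {#\<chi> v#} :: 'b mpowser)"
    by (simp add: mvar_def mmonom_def)
  then show ?case
    using insert by (simp flip: mmonom_add)
qed (simp add: mmonom_empty)

text \<open>Holds for infinite fibres too, since the sum and \<open>card\<close> then both take the
  default value 0.\<close>

lemma mcoeff_formal_sum_mmonom:
  assumes "\<And>i. i \<in> I \<Longrightarrow> f i = mmonom (g i)"
  shows "mcoeff (formal_sum I f) M = of_nat (card {i \<in> I. g i = M})"
proof -
  have "{i \<in> I. mcoeff (f i) M \<noteq> 0} = {i \<in> I. g i = M}"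
    using assms by (auto simp: mcoeff_mmonom split: if_splits)
  then have "mcoeff (formal_sum I f) M = (\<Sum>i | i \<in> I \<and> g i = M. mcoeff (f i) M)"
    by (simp add: formal_sum_def)
  also have "\<dots> = (\<Sum>i | i \<in> I \<and> g i = M. 1)"
    using assms by (intro sum.cong) (auto simp: mcoeff_mmonom)
  finally show ?thesis by simp
qed

lemma mcoeff_of_int: "mcoeff (of_int c) M = (if M = {#} then of_int c else 0)"
proof -
  have nat: "mcoeff (of_nat n) M = (if M = {#} then of_nat n else 0)" for n
    by (induction n) (auto simp: mcoeff_one)
  show ?thesis
    by (cases c rule: int_diff_cases) (simp add: nat)
qed

lemma mcoeff_of_int_mult: "mcoeff (of_int c * f) M = of_int c * mcoeff f M"
proof -
  have "mcoeff (of_int c * f) M = (\<Sum>B\<in>{{#}}. mcoeff (of_int c) B * mcoeff f (M - B))"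
    unfolding mcoeff_mult
    by (rule sum.mono_neutral_right) (auto simp: mcoeff_of_int finite_submultisets)
  then show ?thesis by (simp add: mcoeff_of_int)
qed

lemma mcoeff_sum: "mcoeff (\<Sum>i\<in>I. f i) M = (\<Sum>i\<in>I. mcoeff (f i) M)"
  by (induction I rule: infinite_finite_induct) auto

section \<open>Elementary symmetric functions\<close>

text \<open>The squarefree monomials, which are those occurring in elementary symmetric
  functions.\<close>

definition multilinear_mset :: "nat multiset \<Rightarrow> bool" where
  "multilinear_mset M \<longleftrightarrow> (\<forall>i. count M i \<le> 1)"

lemma multilinear_mset_iff: "multilinear_mset M \<longleftrightarrow> M = mset_set (set_mset M)"
  unfolding multilinear_mset_def multiset_eq_iff
  by (metis count_mset_set(1,3) count_eq_zero_iff finite_set_mset le_numeral_extra(4)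
      le_0_eq le_Suc_eq One_nat_def zero_le)

lemma mcoeff_elem_sym:
  "mcoeff (elem_sym k) M = (if size M = k \<and> multilinear_mset M then 1 else 0)"
proof -
  have "mcoeff (elem_sym k) M = int (card {I \<in> {I. finite I \<and> card I = k}. mset_set I = M})"
    unfolding elem_sym_def by (rule mcoeff_formal_sum_mmonom) (simp add: prod_mvar)
  also have "{I \<in> {I. finite I \<and> card I = k}. mset_set I = M} =
      (if size M = k \<and> multilinear_mset M then {set_mset M} else {})"
    by (auto simp: multilinear_mset_iff simp del: size_mset_set)
       (metis size_mset_set)+
  finally show ?thesis by simp
qed

lemma elem_sym_0: "elem_sym 0 = 1"
  by (rule mpowser_eqI) (auto simp: mcoeff_elem_sym mcoeff_one multilinear_mset_def)

lemma elem_sym_part_empty: "elem_sym_part {#} = 1"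
  and elem_sym_part_add: "elem_sym_part (add_mset k p) = elem_sym k * elem_sym_part p"
  by (simp_all add: elem_sym_part_def)

text \<open>Homogeneity. It later discards the terms of wrong degree from an expansion of the
  chromatic symmetric function.\<close>

lemma mcoeff_elem_sym_part_eq_0:
  "size M \<noteq> sum_mset p \<Longrightarrow> mcoeff (elem_sym_part p) M = 0"
proof (induction p arbitrary: M)
  case (add k p)
  have "mcoeff (elem_sym k) A * mcoeff (elem_sym_part p) (M - A) = 0" if "A \<subseteq># M" for A
  proof (cases "size A = k")
    case True
    then have "size (M - A) \<noteq> sum_mset p"
      using that add.prems size_mset_mono[OF that] by (auto simp: size_Diff_submset)
    then show ?thesis by (simp add: add.IH)
  qed (simp add: mcoeff_elem_sym)
  then show ?case
    by (auto simp: elem_sym_part_add mcoeff_mult intro: sum.neutral)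
qed (simp add: elem_sym_part_empty mcoeff_one)

section \<open>Linear independence\<close>

text \<open>Substitutes 0 for every variable of index at least \<open>k\<close>, so exactly
  \<open>k\<close> variables survive. This ring homomorphism kills \<open>elem_sym (Suc k)\<close>
  and turns \<open>elem_sym k\<close> into a single monomial.\<close>

definition restrict_vars :: "nat \<Rightarrow> 'a::comm_ring_1 mpowser \<Rightarrow> 'a mpowser" where
  "restrict_vars k f = Abs_mpowser (\<lambda>M. if set_mset M \<subseteq> {..<k} then mcoeff f M else 0)"

lemma mcoeff_restrict_vars:
  "mcoeff (restrict_vars k f) M = (if set_mset M \<subseteq> {..<k} then mcoeff f M else 0)"
  by (simp add: restrict_vars_def)

lemma restrict_vars_mult: "restrict_vars k (f * g) = restrict_vars k f * restrict_vars k g"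
proof (rule mpowser_eqI)
  fix M
  show "mcoeff (restrict_vars k (f * g)) M = mcoeff (restrict_vars k f * restrict_vars k g) M"
  proof (cases "set_mset M \<subseteq> {..<k}")
    case True
    then have "set_mset A \<subseteq> {..<k} \<and> set_mset (M - A) \<subseteq> {..<k}" if "A \<subseteq># M" for A
      using that by (meson diff_subset_eq_self set_mset_mono subset_trans)
    then show ?thesis
      using True by (simp add: mcoeff_restrict_vars mcoeff_mult)
  next
    case False
    have "\<not> set_mset A \<subseteq> {..<k} \<or> \<not> set_mset (M - A) \<subseteq> {..<k}" if "A \<subseteq># M" for A
      using that False by (metis Un_subset_iff set_mset_union subset_mset.add_diff_inverse)
    then have "(\<Sum>A | A \<subseteq># M. mcoeff (restrict_vars k f) A * mcoeff (restrict_vars k g) (M - A)) = 0"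
      by (intro sum.neutral) (auto simp: mcoeff_restrict_vars)
    then show ?thesis
      using False by (simp add: mcoeff_restrict_vars mcoeff_mult)
  qed
qed

lemma restrict_vars_add: "restrict_vars k (f + g) = restrict_vars k f + restrict_vars k g"
  by (rule mpowser_eqI) (simp add: mcoeff_restrict_vars)

lemma restrict_vars_sum: "restrict_vars k (\<Sum>i\<in>I. f i) = (\<Sum>i\<in>I. restrict_vars k (f i))"
  by (rule mpowser_eqI) (simp add: mcoeff_restrict_vars mcoeff_sum)

lemma restrict_vars_Suc: "restrict_vars k (restrict_vars (Suc k) f) = restrict_vars k f"
  by (rule mpowser_eqI) (force simp: mcoeff_restrict_vars)

lemma restrict_vars_0: "restrict_vars k 0 = 0"
  by (rule mpowser_eqI) (simp add: mcoeff_restrict_vars)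

lemma restrict_vars_elem_sym_Suc: "restrict_vars k (elem_sym (Suc k)) = 0"
proof (rule mpowser_eqI)
  fix M
  have "size M \<le> k" if "set_mset M \<subseteq> {..<k}" "multilinear_mset M"
    using that card_mono[of "{..<k}" "set_mset M"]
    by (metis card_lessThan finite_lessThan multilinear_mset_iff size_mset_set)
  then show "mcoeff (restrict_vars k (elem_sym (Suc k))) M = mcoeff 0 M"
    by (auto simp: mcoeff_restrict_vars mcoeff_elem_sym)
qed

lemma restrict_vars_elem_sym_self: "restrict_vars k (elem_sym k) = mmonom (mset_set {..<k})"
proof (rule mpowser_eqI)
  fix M
  have "set_mset M \<subseteq> {..<k} \<and> size M = k \<and> multilinear_mset M \<longleftrightarrow> M = mset_set {..<k}"
  proof
    assume *: "set_mset M \<subseteq> {..<k} \<and> size M = k \<and> multilinear_mset M"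
    then have "card (set_mset M) = k" by (metis multilinear_mset_iff size_mset_set)
    then have "set_mset M = {..<k}"
      using * by (simp add: card_subset_eq)
    then show "M = mset_set {..<k}" using * by (metis multilinear_mset_iff)
  qed (auto simp: multilinear_mset_iff)
  then show "mcoeff (restrict_vars k (elem_sym k)) M = mcoeff (mmonom (mset_set {..<k})) M"
    by (auto simp: mcoeff_restrict_vars mcoeff_elem_sym mcoeff_mmonom)
qed

text \<open>Outer induction on the number of variables, inner induction on the total number of
  parts. Setting one more variable to 0 kills all terms with a part \<open>Suc k\<close>, so the
  outer hypothesis removes the others. What remains is divisible by \<open>elem_sym (Suc k)\<close>,
  which in \<open>Suc k\<close> variables is a cancellable monomial; cancelling it takes one part
  from each remaining partition.\<close>

lemma elem_sym_part_independent_restrict: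
  assumes "finite F" and "\<And>p x. p \<in> F \<Longrightarrow> x \<in># p \<Longrightarrow> 0 < x \<and> x \<le> k"
    and "restrict_vars k (\<Sum>p\<in>F. of_int (c p) * elem_sym_part p) = 0" and "p \<in> F"
  shows "c p = 0"
  using assms
proof (induction k arbitrary: F c p)
  case 0
  then have "F = {{#}}"
    by (metis empty_iff equals0I insertI1 is_singletonI' is_singleton_def multiset_nonemptyE
        not_less singletonD)
  then have "p = {#}" and "restrict_vars 0 (of_int (c {#}) * 1 :: int mpowser) = 0"
    using 0 by (simp_all add: elem_sym_part_empty)
  then have "mcoeff (restrict_vars 0 (of_int (c p) :: int mpowser)) {#} = 0" by simp
  then show ?case by (simp add: mcoeff_restrict_vars mcoeff_of_int)
next
  case (Suc k)
  from Suc.prems show ?case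
  proof (induction "\<Sum>p\<in>F. size p" arbitrary: F c p rule: less_induct)
    case less
    define F0 F1 where "F0 = {p \<in> F. Suc k \<notin># p}" and "F1 = {p \<in> F. Suc k \<in># p}"
    have F: "F = F0 \<union> F1" "F0 \<inter> F1 = {}" "finite F0" "finite F1"
      using less.prems(1) by (auto simp: F0_def F1_def)
    define q where "q = (\<lambda>p. p - {#Suc k#})"
    have q: "p = add_mset (Suc k) (q p)" if "p \<in> F1" for p
      using that by (simp add: F1_def q_def)
    have inj: "inj_on q F1" by (metis inj_onI q)
    let ?t = "\<lambda>p. of_int (c p) * elem_sym_part p"
    have t: "?t p = elem_sym (Suc k) * (of_int (c p) * elem_sym_part (q p))" if "p \<in> F1" for p
      by (subst q[OF that], subst elem_sym_part_add) (simp add: algebra_simps flip: q[OF that])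
    have "restrict_vars k (?t p) = 0" if "p \<in> F1" for p
      unfolding t[OF that] by (simp add: restrict_vars_mult restrict_vars_elem_sym_Suc)
    then have "restrict_vars k (sum ?t F1) = 0" by (simp add: restrict_vars_sum)
    moreover have "restrict_vars k (sum ?t F) = 0"
      by (metis less.prems(3) restrict_vars_0 restrict_vars_Suc)
    moreover have sum: "sum ?t F = sum ?t F0 + sum ?t F1"
      using F by (simp add: sum.union_disjoint)
    ultimately have "restrict_vars k (sum ?t F0) = 0" by (simp add: restrict_vars_add)
    then have c0: "c p = 0" if "p \<in> F0" for p
    proof (intro Suc.IH[OF _ _ _ that, of c])
      fix p x assume "p \<in> F0" "x \<in># p"
      then show "0 < x \<and> x \<le> k"
        using less.prems(2)[of p x] by (auto simp: F0_def le_Suc_eq)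
    qed (use F in auto)
    then have "sum ?t F0 = 0" by simp
    then have "restrict_vars (Suc k) (sum ?t F1) = 0"
      using less.prems(3) sum by simp
    moreover have "sum ?t F1 = elem_sym (Suc k) *
        (\<Sum>p\<in>F1. of_int (c p) * elem_sym_part (q p))"
      unfolding sum_distrib_left by (rule sum.cong[OF refl t])
    ultimately have "restrict_vars (Suc k) (\<Sum>p\<in>F1. of_int (c p) * elem_sym_part (q p)) = 0"
      by (simp add: restrict_vars_mult restrict_vars_elem_sym_self mmonom_mult_eq_0_iff)
    moreover have "(\<Sum>p\<in>F1. of_int (c p) * elem_sym_part (q p)) =
        (\<Sum>p\<in>q ` F1. of_int (c (add_mset (Suc k) p)) * elem_sym_part p)"
      using inj q by (simp add: sum.reindex)
    ultimately have r: "restrict_vars (Suc k)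
        (\<Sum>p\<in>q ` F1. of_int (c (add_mset (Suc k) p)) * elem_sym_part p) = 0"
      by simp
    show ?case
    proof (cases "p \<in> F0")
      case False
      then have p: "p \<in> F1" using less.prems(4) F by auto
      have "(\<Sum>p\<in>q ` F1. size p) = (\<Sum>p\<in>F1. size (q p))"
        using inj by (simp add: sum.reindex)
      also have "\<dots> < (\<Sum>p\<in>F1. size p)"
        using p F by (intro sum_strict_mono) (auto, metis lessI q size_add_mset)
      also have "\<dots> \<le> (\<Sum>p\<in>F. size p)"
        using F less.prems(1) by (intro sum_mono2) auto
      finally have "c (add_mset (Suc k) (q p)) = 0"
      proof (intro less.hyps[of "q ` F1" "\<lambda>p. c (add_mset (Suc k) p)" "q p"])
        fix p' x assume "p' \<in> q ` F1" "x \<in># p'"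
        then obtain p where "p \<in> F" "x \<in># p"
          by (metis F(1) UnI2 add_mset_remove_trivial image_iff in_diffD q)
        then show "0 < x \<and> x \<le> Suc k" by (rule less.prems(2))
      qed (use r F p in auto)
      then show ?thesis using q[OF p] by simp
    qed (rule c0)
  qed
qed

lemma elem_sym_part_independent:
  assumes "finite F" and "\<And>p. p \<in> F \<Longrightarrow> 0 \<notin># p"
    and "(\<Sum>p\<in>F. of_int (c p) * elem_sym_part p) = 0" and "p \<in> F"
  shows "c p = 0"
proof -
  let ?k = "Max (\<Union>p\<in>F. set_mset p)"
  have "0 < x \<and> x \<le> ?k" if "p \<in> F" "x \<in># p" for p x
    using that assms(1,2) by (metis Max_ge UN_I finite_UN finite_set_mset gr0I)
  then show ?thesis
    using assms by (intro elem_sym_part_independent_restrict[of F ?k c p])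
      (auto simp: restrict_vars_0)
qed

lemma of_int_combine_sum:
  fixes h :: "'i \<Rightarrow> 'b::comm_ring_1"
  assumes "finite F" "finite F'"
  shows "(\<Sum>p\<in>F. of_int (c p) * h p) + (\<Sum>p\<in>F'. of_int (c' p) * h p) =
    (\<Sum>p\<in>F \<union> F'. of_int ((if p \<in> F then c p else 0) + (if p \<in> F' then c' p else 0)) * h p)"
proof -
  have "(\<Sum>p\<in>F. of_int (c p) * h p) = (\<Sum>p\<in>F \<union> F'. of_int (if p \<in> F then c p else 0) * h p)"
    using assms by (intro sum.mono_neutral_cong_left) auto
  moreover have "(\<Sum>p\<in>F'. of_int (c' p) * h p) =
      (\<Sum>p\<in>F \<union> F'. of_int (if p \<in> F' then c' p else 0) * h p)"
    using assms by (intro sum.mono_neutral_cong_left) auto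
  ultimately show ?thesis
    by (simp only: of_int_add distrib_right sum.distrib)
qed

section \<open>Specialisations\<close>

text \<open>
  The graph of the ring homomorphism on symmetric functions that sends the \<open>k\<close>-th elementary
  symmetric function to \<open>\<epsilon> k\<close>.
\<close>

inductive_set specialisation :: "(nat \<Rightarrow> 'a::comm_ring_1) \<Rightarrow> (int mpowser \<times> 'a) set"
  for \<epsilon> :: "nat \<Rightarrow> 'a" where
  zero: "(0, 0) \<in> specialisation \<epsilon>"
| part: "0 \<notin># p \<Longrightarrow> (elem_sym_part p, \<Prod>k\<in>#p. \<epsilon> k) \<in> specialisation \<epsilon>"
| add: "(f, r) \<in> specialisation \<epsilon> \<Longrightarrow> (g, s) \<in> specialisation \<epsilon> \<Longrightarrow>
    (f + g, r + s) \<in> specialisation \<epsilon>"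
| uminus: "(f, r) \<in> specialisation \<epsilon> \<Longrightarrow> (- f, - r) \<in> specialisation \<epsilon>"

lemma specialisation_expand:
  assumes "(f, r) \<in> specialisation \<epsilon>"
  obtains F c where "finite F" "\<And>p. p \<in> F \<Longrightarrow> 0 \<notin># p"
    "f = (\<Sum>p\<in>F. of_int (c p) * elem_sym_part p)"
    "r = (\<Sum>p\<in>F. of_int (c p) * (\<Prod>k\<in>#p. \<epsilon> k))"
proof -
  have "\<exists>F c. finite F \<and> (\<forall>p\<in>F. 0 \<notin># p) \<and> f = (\<Sum>p\<in>F. of_int (c p) * elem_sym_part p) \<and>
    r = (\<Sum>p\<in>F. of_int (c p) * (\<Prod>k\<in>#p. \<epsilon> k))"
    using assms
  proof induction
    case zero
    show ?case by (intro exI[of _ "{}"]) simp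
  next
    case (part p)
    then show ?case by (intro exI[of _ "{p}"] exI[of _ "\<lambda>_. 1"]) simp
  next
    case (add f r g s)
    then obtain F c F' c' where *: "finite F" "\<forall>p\<in>F. 0 \<notin># p" "finite F'" "\<forall>p\<in>F'. 0 \<notin># p"
      "f = (\<Sum>p\<in>F. of_int (c p) * elem_sym_part p)"
      "r = (\<Sum>p\<in>F. of_int (c p) * (\<Prod>k\<in>#p. \<epsilon> k))"
      "g = (\<Sum>p\<in>F'. of_int (c' p) * elem_sym_part p)"
      "s = (\<Sum>p\<in>F'. of_int (c' p) * (\<Prod>k\<in>#p. \<epsilon> k))"
      by blast
    define d where "d p = (if p \<in> F then c p else 0) + (if p \<in> F' then c' p else 0)" for p
    show ?case
      by (intro exI[of _ "F \<union> F'"] exI[of _ d]) (use * in \<open>auto simp: d_def of_int_combine_sum\<close>)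
  next
    case (uminus f r)
    then obtain F c where *: "finite F" "\<forall>p\<in>F. 0 \<notin># p"
      "f = (\<Sum>p\<in>F. of_int (c p) * elem_sym_part p)"
      "r = (\<Sum>p\<in>F. of_int (c p) * (\<Prod>k\<in>#p. \<epsilon> k))"
      by blast
    show ?case
      by (intro exI[of _ F] exI[of _ "\<lambda>p. - c p"]) (use * in \<open>simp add: sum_negf\<close>)
  qed
  then show thesis using that by blast
qed

text \<open>The difference of the two derivations assigns \<open>r - s\<close> to the zero series,
  and linear independence makes all coefficients in any expansion of 0 vanish.\<close>

lemma specialisation_unique:
  assumes "(f, r) \<in> specialisation \<epsilon>" "(f, s) \<in> specialisation \<epsilon>"
  shows "r = s"
proof -
  have "(f + - f, r + - s) \<in> specialisation \<epsilon>"
    using assms by (intro specialisation.intros)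
  then obtain F c where F: "finite F" "\<And>p. p \<in> F \<Longrightarrow> 0 \<notin># p"
    "0 = (\<Sum>p\<in>F. of_int (c p) * elem_sym_part p)"
    "r + - s = (\<Sum>p\<in>F. of_int (c p) * (\<Prod>k\<in>#p. \<epsilon> k))"
    by (auto elim: specialisation_expand)
  then have "c p = 0" if "p \<in> F" for p
    using elem_sym_part_independent[of F c p] that by simp
  then show ?thesis using F(4) by simp
qed

lemma specialisation_sum:
  "(\<And>i. i \<in> I \<Longrightarrow> (f i, r i) \<in> specialisation \<epsilon>) \<Longrightarrow>
    (\<Sum>i\<in>I. f i, \<Sum>i\<in>I. r i) \<in> specialisation \<epsilon>"
  by (induction I rule: infinite_finite_induct) (auto intro: specialisation.intros)

lemma specialisation_of_int_mult:
  assumes "(f, r) \<in> specialisation \<epsilon>"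
  shows "(of_int c * f, of_int c * r) \<in> specialisation \<epsilon>"
proof -
  have nat: "(of_nat n * f, of_nat n * r) \<in> specialisation \<epsilon>" for n
    by (induction n) (auto simp: algebra_simps intro: specialisation.intros assms)
  show ?thesis
  proof (cases c rule: int_diff_cases)
    case (diff m n)
    then show ?thesis
      using specialisation.add[OF nat[of m] specialisation.uminus[OF nat[of n]]]
      by (simp add: left_diff_distrib)
  qed
qed

lemma specialisation_elem_sym_mult:
  assumes "(f, r) \<in> specialisation \<epsilon>" and "\<epsilon> 0 = 1"
  shows "(elem_sym k * f, \<epsilon> k * r) \<in> specialisation \<epsilon>"
  using assms(1)
\<comment> \<open>Rule \<open>part\<close> forbids parts equal to 0, so \<open>k = 0\<close> rests
  on \<open>elem_sym 0 = 1\<close> and the normalisation \<open>\<epsilon> 0 = 1\<close>.\<close>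
proof (cases "k = 0")
  case False
  from assms(1) show ?thesis
  proof induction
    case (part p)
    then show ?case
      using specialisation.part[of "add_mset k p" \<epsilon>] False by (simp add: elem_sym_part_add)
  qed (auto simp: algebra_simps intro: specialisation.intros dest: specialisation.add
       specialisation.uminus)
qed (simp add: elem_sym_0 assms(2))

lemma specialisation_mult:
  assumes "(f, r) \<in> specialisation \<epsilon>" "(g, s) \<in> specialisation \<epsilon>" "\<epsilon> 0 = 1"
  shows "(f * g, r * s) \<in> specialisation \<epsilon>"
  using assms(1)
proof induction
  case (part p)
  then show ?case
  proof (induction p)
    case empty
    then show ?case using assms(2) by (simp add: elem_sym_part_empty)
  next
    case (add k p)
    then show ?case
      using specialisation_elem_sym_mult[OF add.IH assms(3), of k]
      by (simp add: elem_sym_part_add mult.assoc)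
  qed
qed (auto simp: distrib_right intro: specialisation.intros dest: specialisation.uminus)

lemma specialisation_one: "(1, 1) \<in> specialisation \<epsilon>"
  using specialisation.part[of "{#}" \<epsilon>] by (simp add: elem_sym_part_empty)

section \<open>Power sums\<close>

definition power_sum :: "nat \<Rightarrow> int mpowser" where
  "power_sum b = Abs_mpowser (\<lambda>M. if \<exists>i. M = replicate_mset b i then 1 else 0)"

text \<open>
  The monomial symmetric function of the hook \<open>(b, 1\<^sup>a)\<close>, except that for \<open>b = 1\<close> it
  carries the factor \<open>a + 1\<close>; then Newton's recursion \<open>hook_sum_Newton\<close> holds uniformly.
\<close>

definition hook_sum :: "nat \<Rightarrow> nat \<Rightarrow> int mpowser" where
  "hook_sum a b = Abs_mpowser (\<lambda>M. if size M = a + b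
     then int (card {i \<in> set_mset M. count M i = b \<and> (\<forall>j. j \<noteq> i \<longrightarrow> count M j \<le> 1)}) else 0)"

lemma mcoeff_power_sum:
  "mcoeff (power_sum b) M = (if \<exists>i. M = replicate_mset b i then 1 else 0)"
  by (simp add: power_sum_def)

lemma mcoeff_power_sum_mult:
  assumes "0 < b"
  shows "mcoeff (power_sum b * f) M =
    (\<Sum>i | i \<in># M \<and> b \<le> count M i. mcoeff f (M - replicate_mset b i))"
proof -
  let ?R = "replicate_mset b"
  have "mcoeff (power_sum b * f) M =
      (\<Sum>A | A \<subseteq># M \<and> (\<exists>i. A = ?R i). mcoeff f (M - A))"
    unfolding mcoeff_mult mcoeff_power_sum
    by (rule sum.mono_neutral_cong_right) (auto simp: finite_submultisets)
  also have "{A. A \<subseteq># M \<and> (\<exists>i. A = ?R i)} = ?R ` {i. i \<in># M \<and> b \<le> count M i}"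
    using assms by (auto simp flip: count_greater_zero_iff count_le_replicate_mset_subset_eq)
  also have "sum (\<lambda>A. mcoeff f (M - A)) \<dots> =
      (\<Sum>i | i \<in># M \<and> b \<le> count M i. mcoeff f (M - ?R i))"
    using assms by (subst sum.reindex) (auto simp: inj_on_def replicate_mset_eq_iff)
  finally show ?thesis .
qed

lemma power_sum_eq_hook_sum:
  assumes "0 < b"
  shows "power_sum b = hook_sum 0 b"
proof (rule mpowser_eqI)
  fix M :: "nat multiset"
  have M: "M = replicate_mset b i" if "size M = b" "count M i = b" for i
    using that by (metis count_le_replicate_mset_subset_eq order_refl
        size_replicate_mset mset_subset_size subset_mset.le_neq_trans less_irrefl)
  show "mcoeff (power_sum b) M = mcoeff (hook_sum 0 b) M"
  proof (cases "\<exists>i. M = replicate_mset b i")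
    case True
    then obtain i where i: "M = replicate_mset b i" by blast
    have "{j \<in> set_mset M. count M j = b \<and> (\<forall>l. l \<noteq> j \<longrightarrow> count M l \<le> 1)} = {i}"
      using assms by (auto simp: i)
    then show ?thesis
      using i by (auto simp: mcoeff_power_sum hook_sum_def)
  next
    case False
    then have "{j \<in> set_mset M. count M j = b \<and> (\<forall>l. l \<noteq> j \<longrightarrow> count M l \<le> 1)} = {}"
      if "size M = b"
      using M that by blast
    then have "mcoeff (hook_sum 0 b) M = 0"
      unfolding hook_sum_def mcoeff_Abs by (cases "size M = b") (simp_all only: add_0 if_cancel if_False card.empty of_nat_0)
    then show ?thesis
      using False by (simp add: mcoeff_power_sum)
  qed
qed

text \<open>For \<open>b = 1\<close> each of the \<open>a + 1\<close> variables of a squarefree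
  monomial qualifies as the distinguished one.\<close>

lemma hook_sum_1: "hook_sum a 1 = of_int (int a + 1) * elem_sym (a + 1)"
proof (rule mpowser_eqI)
  fix M :: "nat multiset"
  have *: "{i \<in> set_mset M. count M i = 1 \<and> (\<forall>j. j \<noteq> i \<longrightarrow> count M j \<le> 1)} =
      (if multilinear_mset M then set_mset M else {})"
  proof (intro set_eqI)
    fix i
    have "count M i = 1 \<longleftrightarrow> count M i \<le> 1" if "i \<in># M"
      using that by (metis One_nat_def Suc_leI count_greater_zero_iff le_antisym order_refl)
    then have "i \<in># M \<Longrightarrow> (count M i = 1 \<and> (\<forall>j. j \<noteq> i \<longrightarrow> count M j \<le> 1)) = multilinear_mset M"
      unfolding multilinear_mset_def by metis
    then show "i \<in> {i \<in> set_mset M. count M i = 1 \<and> (\<forall>j. j \<noteq> i \<longrightarrow> count M j \<le> 1)} \<longleftrightarrow>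
        i \<in> (if multilinear_mset M then set_mset M else {})"
      by (cases "i \<in># M") simp_all
  qed
  have "card (set_mset M) = size M" if "multilinear_mset M"
    using that by (metis multilinear_mset_iff size_mset_set)
  then show "mcoeff (hook_sum a 1) M = mcoeff (of_int (int a + 1) * elem_sym (a + 1)) M"
    unfolding hook_sum_def mcoeff_Abs * by (simp add: mcoeff_of_int_mult mcoeff_elem_sym del: of_int_add)
qed

text \<open>Multiplying the \<open>b\<close>-th power of variable \<open>i\<close> by a squarefree
  monomial of degree \<open>Suc a\<close> gives exponent \<open>b\<close> or \<open>Suc b\<close> at
  \<open>i\<close>, according to whether \<open>i\<close> is absent from that monomial or present.
  These are the two hooks on the right.\<close>

lemma hook_sum_Newton:
  assumes "0 < b"
  shows "power_sum b * elem_sym (Suc a) = hook_sum (Suc a) b + hook_sum a (Suc b)"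
proof (rule mpowser_eqI)
  fix M :: "nat multiset"
  let ?H = "\<lambda>b. {i \<in> set_mset M. count M i = b \<and> (\<forall>j. j \<noteq> i \<longrightarrow> count M j \<le> 1)}"
  let ?S = "{i. i \<in># M \<and> b \<le> count M i}"
  have fin: "finite {i. i \<in># M \<and> P i}" for P
    by (rule finite_subset[of _ "set_mset M"]) auto
  have ml: "multilinear_mset (M - replicate_mset b i) \<longleftrightarrow>
      count M i \<le> Suc b \<and> (\<forall>j. j \<noteq> i \<longrightarrow> count M j \<le> 1)" for i
    by (auto simp: multilinear_mset_def le_diff_conv)
  have sz: "size (M - replicate_mset b i) + b = size M" if "i \<in> ?S" for i
    using that size_mset_mono[of "replicate_mset b i" M]
    by (simp add: size_Diff_submset count_le_replicate_mset_subset_eq)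
  have "mcoeff (power_sum b * elem_sym (Suc a)) M =
      (\<Sum>i\<in>?S. if size M = Suc a + b \<and> count M i \<le> Suc b \<and> (\<forall>j. j \<noteq> i \<longrightarrow> count M j \<le> 1)
        then 1 else 0)"
    unfolding mcoeff_power_sum_mult[OF assms] mcoeff_elem_sym ml
    by (rule sum.cong) (use sz in force)+
  also have "\<dots> = (if size M = Suc a + b then int (card (?H b \<union> ?H (Suc b))) else 0)"
  proof (cases "size M = Suc a + b")
    case True
    then have "(\<Sum>i\<in>?S. if size M = Suc a + b \<and> count M i \<le> Suc b \<and> (\<forall>j. j \<noteq> i \<longrightarrow> count M j \<le> 1)
        then 1 else 0 :: int) = (\<Sum>i\<in>?H b \<union> ?H (Suc b). 1)"
      by (intro sum.mono_neutral_cong_right) (auto simp: fin)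
    then show ?thesis using True by simp
  qed simp
  also have "card (?H b \<union> ?H (Suc b)) = card (?H b) + card (?H (Suc b))"
    by (intro card_Un_disjoint) (auto simp: fin)
  finally show "mcoeff (power_sum b * elem_sym (Suc a)) M =
      mcoeff (hook_sum (Suc a) b + hook_sum a (Suc b)) M"
    by (simp add: hook_sum_def)
qed

text \<open>Being in the domain of a specialisation is a way to say: being a polynomial in the \<open>elem_sym k\<close>.\<close>

lemma hook_sum_specialisation:
  fixes \<epsilon> :: "nat \<Rightarrow> 'a::comm_ring_1"
  assumes "\<epsilon> 0 = 1" "0 < b"
  shows "hook_sum a b \<in> Domain (specialisation \<epsilon>)"
  using assms(2)
proof (induction b arbitrary: a)
  case (Suc b)
  have e: "(elem_sym k, \<epsilon> k) \<in> specialisation \<epsilon>" for k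
    using specialisation_elem_sym_mult[OF specialisation_one[of \<epsilon>] assms(1), of k] by simp
  show ?case
  proof (cases "b = 0")
    case True
    then show ?thesis
      using specialisation_of_int_mult[OF e[of "a + 1"], of "int a + 1"] hook_sum_1[of a]
      unfolding Domain_iff One_nat_def by auto
  next
    case False
    then obtain r s where "(power_sum b, r) \<in> specialisation \<epsilon>"
      and s: "(hook_sum (Suc a) b, s) \<in> specialisation \<epsilon>"
      using Suc.IH[of 0] Suc.IH[of "Suc a"] power_sum_eq_hook_sum[of b] by (auto simp: Domain_iff)
    \<comment> \<open>Newton's recursion solved for \<open>hook_sum a (Suc b)\<close>. The
      subtracted hook has the larger first argument \<open>Suc a\<close>, which is why the induction
      on \<open>b\<close> leaves \<open>a\<close> arbitrary.\<close>
    from specialisation.add[OF specialisation_mult[OF this(1) e assms(1)] specialisation.uminus[OF s],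
        of "Suc a"]
    show ?thesis using False by (auto simp: hook_sum_Newton)
  qed
qed simp

lemma power_sum_specialisation:
  "\<epsilon> 0 = 1 \<Longrightarrow> 0 < b \<Longrightarrow> power_sum b \<in> Domain (specialisation \<epsilon>)"
  by (simp add: power_sum_eq_hook_sum hook_sum_specialisation)

section \<open>Splitting off one variable\<close>

lemma replicate_mset_plus: "replicate_mset (m + n) x = replicate_mset m x + replicate_mset n x"
  by (rule multiset_eqI) simp

text \<open>The coefficient of the \<open>j\<close>-th power of the first variable, as a series in the others.\<close>

definition first_var_coeff :: "nat \<Rightarrow> 'a::comm_ring_1 mpowser \<Rightarrow> 'a mpowser" where
  "first_var_coeff j f = Abs_mpowser (\<lambda>M. mcoeff f (image_mset Suc M + replicate_mset j 0))"

lemma mcoeff_first_var_coeff: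
  "mcoeff (first_var_coeff j f) M = mcoeff f (image_mset Suc M + replicate_mset j 0)"
  by (simp add: first_var_coeff_def)

text \<open>With \<open>first_var_decomp_exists\<close> this makes every monomial split uniquely
  into a power of the first variable and a shifted monomial in the others.\<close>

lemma first_var_decomp_eq_iff:
  "image_mset Suc A + replicate_mset i 0 = image_mset Suc B + replicate_mset j 0 \<longleftrightarrow> A = B \<and> i = j"
proof
  assume eq: "image_mset Suc A + replicate_mset i 0 = image_mset Suc B + replicate_mset j 0"
  have "count (image_mset Suc M) 0 = 0" for M by (auto simp: count_eq_zero_iff)
  then have "i = j" using arg_cong[OF eq, of "\<lambda>M. count M 0"] by simp
  then have "image_mset Suc A = image_mset Suc B" using eq by simp
  then have "image_mset (\<lambda>x. x - 1) (image_mset Suc A) = image_mset (\<lambda>x. x - 1) (image_mset Suc B)"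
    by simp
  then show "A = B \<and> i = j" using \<open>i = j\<close> by (simp add: image_mset.compositionality comp_def)
qed simp

lemma first_var_decomp_exists:
  obtains A i where "M = image_mset Suc A + replicate_mset i 0"
proof -
  have "\<exists>A i. M = image_mset Suc A + replicate_mset i 0"
  proof (induction M)
    case empty
    show ?case by (intro exI[of _ "{#}"] exI[of _ 0]) simp
  next
    case (add x M)
    then obtain A i where M: "M = image_mset Suc A + replicate_mset i 0" by blast
    show ?case
    proof (cases x)
      case 0
      then show ?thesis using M by (intro exI[of _ A] exI[of _ "Suc i"]) simp
    next
      case (Suc y)
      then show ?thesis using M by (intro exI[of _ "add_mset y A"] exI[of _ i]) simp
    qed
  qed
  then show thesis using that by blast
qed

lemma first_var_decomp_subseteq_iff:
  "image_mset Suc A + replicate_mset i 0 \<subseteq># image_mset Suc B + replicate_mset j 0 \<longleftrightarrow>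
    A \<subseteq># B \<and> i \<le> j"
proof
  assume "image_mset Suc A + replicate_mset i 0 \<subseteq># image_mset Suc B + replicate_mset j 0"
  then obtain C where C: "image_mset Suc B + replicate_mset j 0 =
      image_mset Suc A + replicate_mset i 0 + C"
    by (auto simp: subset_mset.le_iff_add)
  obtain D l where "C = image_mset Suc D + replicate_mset l 0" by (rule first_var_decomp_exists)
  then have "image_mset Suc B + replicate_mset j 0 =
      image_mset Suc (A + D) + replicate_mset (i + l) 0"
    using C by (simp add: replicate_mset_plus)
  then show "A \<subseteq># B \<and> i \<le> j" unfolding first_var_decomp_eq_iff by auto
next
  assume "A \<subseteq># B \<and> i \<le> j"
  then show "image_mset Suc A + replicate_mset i 0 \<subseteq># image_mset Suc B + replicate_mset j 0"
    by (intro subset_mset.add_mono image_mset_subseteq_mono)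
      (auto simp flip: count_le_replicate_mset_subset_eq)
qed

lemma first_var_coeff_mult:
  "first_var_coeff j (f * g) = (\<Sum>i\<le>j. first_var_coeff i f * first_var_coeff (j - i) g)"
proof (rule mpowser_eqI)
  fix M
  let ?u = "\<lambda>M j. image_mset Suc M + replicate_mset j 0"
  have sub: "{A. A \<subseteq># ?u M j} = (\<lambda>(i, B). ?u B i) ` ({..j} \<times> {B. B \<subseteq># M})" (is "_ = ?R")
  proof (intro equalityI subsetI)
    fix A assume A: "A \<in> {A. A \<subseteq># ?u M j}"
    obtain B i where B: "A = ?u B i" by (rule first_var_decomp_exists)
    with A show "A \<in> ?R" by (auto simp: first_var_decomp_subseteq_iff)
  qed (auto simp: first_var_decomp_subseteq_iff)
  have inj: "inj_on (\<lambda>(i, B). ?u B i) S" for S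
    by (auto simp: inj_on_def first_var_decomp_eq_iff)
  have diff: "?u M j - ?u B i = ?u (M - B) (j - i)" if "i \<le> j" "B \<subseteq># M" for B i
  proof -
    have "?u M j = ?u (M - B + B) (j - i + i)" using that by simp
    also have "\<dots> = ?u (M - B) (j - i) + ?u B i"
      by (simp only: image_mset_union replicate_mset_plus ac_simps)
    finally show ?thesis by simp
  qed
  have "mcoeff (first_var_coeff j (f * g)) M =
      (\<Sum>(i, B)\<in>{..j} \<times> {B. B \<subseteq># M}. mcoeff f (?u B i) * mcoeff g (?u M j - ?u B i))"
    unfolding mcoeff_first_var_coeff mcoeff_mult sub
    by (subst sum.reindex[OF inj]) (simp add: case_prod_unfold)
  also have "\<dots> = (\<Sum>(i, B)\<in>{..j} \<times> {B. B \<subseteq># M}.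
      mcoeff (first_var_coeff i f) B * mcoeff (first_var_coeff (j - i) g) (M - B))"
    by (rule sum.cong) (auto simp: diff mcoeff_first_var_coeff)
  also have "\<dots> = mcoeff (\<Sum>i\<le>j. first_var_coeff i f * first_var_coeff (j - i) g) M"
    by (simp add: mcoeff_sum mcoeff_mult sum.cartesian_product)
  finally show "mcoeff (first_var_coeff j (f * g)) M =
      mcoeff (\<Sum>i\<le>j. first_var_coeff i f * first_var_coeff (j - i) g) M" .
qed

lemma first_var_coeff_one: "first_var_coeff j 1 = (if j = 0 then 1 else 0)"
  by (rule mpowser_eqI) (auto simp: mcoeff_first_var_coeff mcoeff_one)

lemma all_nat_iff: "(\<forall>i. P i) \<longleftrightarrow> P 0 \<and> (\<forall>i. P (Suc i))"
  by (metis not0_implies_Suc)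

text \<open>A squarefree monomial contains the first variable at most once: e_k of the full alphabet
  is e_k of the remaining variables plus x_0 times their e_(k-1). Shifting indices identifies the
  remaining variables with the full alphabet again.\<close>

lemma first_var_coeff_elem_sym:
  assumes "0 < k"
  shows "first_var_coeff j (elem_sym k) =
    (if j = 0 then elem_sym k else if j = 1 then elem_sym (k - 1) else 0)"
proof (rule mpowser_eqI)
  fix M
  have "count (image_mset Suc M) 0 = 0" by (auto simp: count_eq_zero_iff)
  moreover have "count (image_mset Suc M) (Suc i) = count M i" for i
    by (induction M) auto
  ultimately have "multilinear_mset (image_mset Suc M + replicate_mset j 0) \<longleftrightarrow>
      multilinear_mset M \<and> j \<le> 1"
    unfolding multilinear_mset_def by (subst (1) all_nat_iff) auto
  then show "mcoeff (first_var_coeff j (elem_sym k)) M =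
      mcoeff (if j = 0 then elem_sym k else if j = 1 then elem_sym (k - 1) else 0) M"
    using assms by (auto simp: mcoeff_first_var_coeff mcoeff_elem_sym)
qed

lemma first_var_coeff_elem_sym_mult:
  assumes "0 < k"
  shows "first_var_coeff j (elem_sym k * f) = elem_sym k * first_var_coeff j f +
    (if j = 0 then 0 else elem_sym (k - 1) * first_var_coeff (j - 1) f)"
proof -
  have "first_var_coeff j (elem_sym k * f) =
      (\<Sum>i\<in>(if j = 0 then {0} else {0, 1}). first_var_coeff i (elem_sym k) * first_var_coeff (j - i) f)"
    unfolding first_var_coeff_mult
    by (rule sum.mono_neutral_right) (auto simp: first_var_coeff_elem_sym[OF assms])
  then show ?thesis by (simp add: first_var_coeff_elem_sym[OF assms])
qed

text \<open>The polynomial indeterminate plays the role of the first variable, so extracting its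
  coefficient commutes with evaluation. At index 0 truncated subtraction gives the polynomial
  \<open>1 + X\<close> instead of 1, which is harmless because \<open>part\<close> only uses
  positive parts.\<close>

lemma specialisation_first_var_coeff:
  assumes "(f, q) \<in> specialisation (\<lambda>k. [:\<epsilon> k, \<epsilon> (k - 1):])" and "\<epsilon> 0 = 1"
  shows "(first_var_coeff j f, coeff q j) \<in> specialisation \<epsilon>"
  using assms(1)
proof (induction arbitrary: j)
  case zero
  have "first_var_coeff j 0 = (0 :: int mpowser)"
    by (rule mpowser_eqI) (simp add: mcoeff_first_var_coeff)
  then show ?case by (simp add: specialisation.zero)
next
  case (part p)
  then show ?case
  proof (induction p arbitrary: j)
    case empty
    then show ?case
      by (auto simp: elem_sym_part_empty first_var_coeff_one specialisation_one
          intro: specialisation.zero)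
  next
    case (add k p)
    have IH: "(first_var_coeff j (elem_sym_part p),
        coeff (\<Prod>k\<in>#p. [:\<epsilon> k, \<epsilon> (k - 1):]) j) \<in> specialisation \<epsilon>" for j
      using add by simp
    have "0 < k" using add.prems by auto
    show ?case
      unfolding elem_sym_part_add first_var_coeff_elem_sym_mult[OF \<open>0 < k\<close>] image_mset_add_mset
        prod_mset.add_mset mult_pCons_left coeff_add coeff_smult coeff_pCons
      using specialisation_elem_sym_mult[OF IH assms(2)]
      by (intro specialisation.add) (auto split: nat.split intro: specialisation.zero)
  qed
next
  case (add f r g s)
  have "first_var_coeff j (f + g) = first_var_coeff j f + first_var_coeff j g"
    by (rule mpowser_eqI) (simp add: mcoeff_first_var_coeff)
  then show ?case using add by (simp add: specialisation.add)
next
  case (uminus f r)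
  have "first_var_coeff j (- f) = - first_var_coeff j f"
    by (rule mpowser_eqI) (simp add: mcoeff_first_var_coeff)
  then show ?case using uminus by (simp add: specialisation.uminus)
qed

section \<open>Colourings of weighted vertices\<close>

text \<open>A vertex of weight \<open>w v\<close> stands for \<open>w v\<close> original vertices
  merged by contraction, so its colour counts that many times.\<close>

definition colouring_monom :: "'v set \<Rightarrow> ('v \<Rightarrow> nat) \<Rightarrow> ('v \<Rightarrow> nat) \<Rightarrow> nat multiset" where
  "colouring_monom W w \<chi> = (\<Sum>v\<in>W. replicate_mset (w v) (\<chi> v))"

definition weighted_colourings :: "'v set \<Rightarrow> ('v \<times> 'v) set \<Rightarrow> ('v \<Rightarrow> nat) set" where
  "weighted_colourings W T = {\<chi> \<in> W \<rightarrow>\<^sub>E UNIV. \<forall>(u, v)\<in>T. \<chi> u \<noteq> \<chi> v}"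

definition weighted_chromatic :: "'v set \<Rightarrow> ('v \<Rightarrow> nat) \<Rightarrow> ('v \<times> 'v) set \<Rightarrow> int mpowser" where
  "weighted_chromatic W w T =
    Abs_mpowser (\<lambda>M. int (card {\<chi> \<in> weighted_colourings W T. colouring_monom W w \<chi> = M}))"

lemma colouring_monom_insert:
  "finite W \<Longrightarrow> v \<notin> W \<Longrightarrow>
    colouring_monom (insert v W) w \<chi> = replicate_mset (w v) (\<chi> v) + colouring_monom W w \<chi>"
  by (simp add: colouring_monom_def)

lemma colouring_monom_cong:
  "(\<And>v. v \<in> W \<Longrightarrow> w v = w' v) \<Longrightarrow> (\<And>v. v \<in> W \<Longrightarrow> \<chi> v = \<chi>' v) \<Longrightarrow>
    colouring_monom W w \<chi> = colouring_monom W w' \<chi>'"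
  by (simp add: colouring_monom_def)

text \<open>Positive weights make every colour in use visible in \<open>M\<close>, which leaves
  finitely many choices at each vertex.\<close>

lemma finite_colourings_monom:
  assumes "finite W" "\<And>v. v \<in> W \<Longrightarrow> 0 < w v"
  shows "finite {\<chi> \<in> weighted_colourings W T. colouring_monom W w \<chi> = M}"
proof (rule finite_subset)
  show "{\<chi> \<in> weighted_colourings W T. colouring_monom W w \<chi> = M} \<subseteq> W \<rightarrow>\<^sub>E set_mset M"
  proof
    fix \<chi> assume \<chi>: "\<chi> \<in> {\<chi> \<in> weighted_colourings W T. colouring_monom W w \<chi> = M}"
    have "\<chi> v \<in># M" if "v \<in> W" for v
    proof -
      have "\<chi> v \<in># replicate_mset (w v) (\<chi> v)" using assms(2)[OF that] by simp
      moreover have "M = replicate_mset (w v) (\<chi> v) + colouring_monom (W - {v}) w \<chi>"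
        using \<chi> that assms(1) by (auto simp: colouring_monom_def sum.remove)
      ultimately show ?thesis by simp
    qed
    then show "\<chi> \<in> W \<rightarrow>\<^sub>E set_mset M"
      using \<chi> by (auto simp: weighted_colourings_def PiE_iff)
  qed
  show "finite (W \<rightarrow>\<^sub>E set_mset M)" using assms by (intro finite_PiE) auto
qed

text \<open>An unconstrained vertex takes its colour \<open>i\<close> freely and contributes the
  \<open>w u\<close>-th power of variable \<open>i\<close>; summing over \<open>i\<close> gives the
  power sum.\<close>

lemma weighted_chromatic_insert_vertex:
  assumes "finite W" "\<And>v. v \<in> insert u W \<Longrightarrow> 0 < w v" "u \<notin> W"
  shows "weighted_chromatic (insert u W) w {} = power_sum (w u) * weighted_chromatic W w {}"
proof (rule mpowser_eqI)
  fix M :: "nat multiset"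
  let ?R = "replicate_mset (w u)"
  let ?A = "{i. i \<in># M \<and> w u \<le> count M i}"
  let ?S = "\<lambda>i. {\<chi> \<in> weighted_colourings W {}. colouring_monom W w \<chi> = M - ?R i}"
  have bij: "bij_betw (\<lambda>\<chi>. (\<chi> u, restrict \<chi> W))
      {\<chi> \<in> weighted_colourings (insert u W) {}. colouring_monom (insert u W) w \<chi> = M}
      (SIGMA i:?A. ?S i)"
  proof (rule bij_betw_byWitness[where f' = "\<lambda>(i, \<chi>). \<chi>(u := i)"])
    show "\<forall>\<chi>\<in>{\<chi> \<in> weighted_colourings (insert u W) {}. colouring_monom (insert u W) w \<chi> = M}.
        (case (\<chi> u, restrict \<chi> W) of (i, \<chi>) \<Rightarrow> \<chi>(u := i)) = \<chi>"
      by (auto simp: weighted_colourings_def PiE_iff extensional_def fun_eq_iff restrict_def)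
    show "\<forall>p\<in>SIGMA i:?A. ?S i. ((case p of (i, \<chi>) \<Rightarrow> \<chi>(u := i)) u,
        restrict (case p of (i, \<chi>) \<Rightarrow> \<chi>(u := i)) W) = p"
      using assms(3)
      by (auto simp: weighted_colourings_def PiE_iff extensional_def fun_eq_iff restrict_def)
    show "(\<lambda>\<chi>. (\<chi> u, restrict \<chi> W)) `
        {\<chi> \<in> weighted_colourings (insert u W) {}. colouring_monom (insert u W) w \<chi> = M}
        \<subseteq> (SIGMA i:?A. ?S i)"
    proof clarsimp
      fix \<chi>
      assume "\<chi> \<in> weighted_colourings (insert u W) {}"
      have "colouring_monom W w (restrict \<chi> W) = colouring_monom W w \<chi>"
        by (rule colouring_monom_cong) auto
      then show "\<chi> u \<in># colouring_monom (insert u W) w \<chi> \<and>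
          w u \<le> count (colouring_monom (insert u W) w \<chi>) (\<chi> u) \<and>
          restrict \<chi> W \<in> weighted_colourings W {} \<and>
          colouring_monom W w (restrict \<chi> W) = colouring_monom (insert u W) w \<chi> - ?R (\<chi> u)"
        using assms(1,3) assms(2)[of u] by (auto simp: colouring_monom_insert weighted_colourings_def)
    qed
    show "(\<lambda>(i, \<chi>). \<chi>(u := i)) ` (SIGMA i:?A. ?S i) \<subseteq>
        {\<chi> \<in> weighted_colourings (insert u W) {}. colouring_monom (insert u W) w \<chi> = M}"
    proof clarify
      fix i \<chi>
      assume *: "w u \<le> count M i" "\<chi> \<in> weighted_colourings W {}" "colouring_monom W w \<chi> = M - ?R i"
      have "colouring_monom W w (\<chi>(u := i)) = colouring_monom W w \<chi>"
        using assms by (intro colouring_monom_cong) auto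
      then show "\<chi>(u := i) \<in> weighted_colourings (insert u W) {} \<and>
          colouring_monom (insert u W) w (\<chi>(u := i)) = M"
        using assms *
        by (auto simp: colouring_monom_insert weighted_colourings_def PiE_iff extensional_def
            count_le_replicate_mset_subset_eq)
    qed
  qed
  have finA: "finite ?A" by (rule finite_subset[of _ "set_mset M"]) auto
  have finS: "finite (?S i)" for i using assms by (intro finite_colourings_monom) auto
  have "0 < w u" using assms by simp
  show "mcoeff (weighted_chromatic (insert u W) w {}) M =
      mcoeff (power_sum (w u) * weighted_chromatic W w {}) M"
    unfolding mcoeff_power_sum_mult[OF \<open>0 < w u\<close>] weighted_chromatic_def mcoeff_Abs
      bij_betw_same_card[OF bij] by (subst card_SigmaI) (auto simp: finA finS)
qed

lemma weighted_chromatic_no_constraint_specialisation: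
  assumes "finite W" "\<And>v. v \<in> W \<Longrightarrow> 0 < w v" "\<epsilon> 0 = 1"
  shows "weighted_chromatic W w {} \<in> Domain (specialisation \<epsilon>)"
  using assms(1,2)
proof induction
  case empty
  have "weighted_chromatic {} w {} = 1"
    by (rule mpowser_eqI)
      (auto simp: weighted_chromatic_def weighted_colourings_def colouring_monom_def mcoeff_one
        if_distrib cong: conj_cong)
  then show ?case using specialisation_one by (auto simp: Domain_iff)
next
  case (insert u W)
  then obtain r where "(weighted_chromatic W w {}, r) \<in> specialisation \<epsilon>" by auto
  moreover obtain s where "(power_sum (w u), s) \<in> specialisation \<epsilon>"
    using power_sum_specialisation[of \<epsilon> "w u"] insert.prems assms(3) by auto
  ultimately have "(power_sum (w u) * weighted_chromatic W w {}, s * r) \<in> specialisation \<epsilon>"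
    using specialisation_mult assms(3) by blast
  then show ?case
    using insert by (subst weighted_chromatic_insert_vertex) auto
qed

text \<open>Deletion-contraction: the colourings lost by adding the constraint are those with equal
  colours at \<open>u\<close> and \<open>v\<close>, that is, the colourings with \<open>v\<close>
  merged into \<open>u\<close>. Adding the weights keeps the monomial, and hence the degree,
  unchanged.\<close>

lemma weighted_chromatic_contract:
  assumes "finite W" "T \<subseteq> W \<times> W" "u \<in> W" "v \<in> W" "u \<noteq> v" "\<And>v. v \<in> W \<Longrightarrow> 0 < w v"
  defines "c \<equiv> (\<lambda>x. if x = v then u else x)"
  shows "weighted_chromatic W w (insert (u, v) T) = weighted_chromatic W w T -
    weighted_chromatic (W - {v}) (w(u := w u + w v)) (map_prod c c ` T)"
proof (rule mpowser_eqI)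
  fix M :: "nat multiset"
  let ?w = "w(u := w u + w v)"
  let ?X = "{\<chi> \<in> weighted_colourings W T. colouring_monom W w \<chi> = M}"
  let ?Y = "{\<chi> \<in> weighted_colourings (W - {v}) (map_prod c c ` T).
      colouring_monom (W - {v}) ?w \<chi> = M}"
  have mono: "colouring_monom W w \<chi> = colouring_monom (W - {v}) ?w \<chi>" if "\<chi> u = \<chi> v" for \<chi>
  proof -
    have W: "W = insert v (insert u (W - {u, v}))" "W - {v} = insert u (W - {u, v})"
      using assms by auto
    have "colouring_monom (W - {u, v}) w \<chi> = colouring_monom (W - {u, v}) ?w \<chi>"
      by (rule colouring_monom_cong) auto
    then show ?thesis
      using assms(1,5) that unfolding W(2) by (subst W(1))
        (simp add: colouring_monom_insert replicate_mset_plus ac_simps)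
  qed
  have T: "x \<in> W" "y \<in> W" if "(x, y) \<in> T" for x y using that assms(2) by auto
  have bij: "bij_betw (\<lambda>\<chi>. restrict \<chi> (W - {v})) {\<chi> \<in> ?X. \<chi> u = \<chi> v} ?Y"
  proof (rule bij_betw_byWitness[where f' = "\<lambda>\<chi>. \<chi>(v := \<chi> u)"])
    show "\<forall>\<chi>\<in>{\<chi> \<in> ?X. \<chi> u = \<chi> v}. (restrict \<chi> (W - {v}))(v := restrict \<chi> (W - {v}) u) = \<chi>"
      using assms by (auto simp: weighted_colourings_def PiE_iff extensional_def fun_eq_iff)
    show "\<forall>\<chi>\<in>?Y. restrict (\<chi>(v := \<chi> u)) (W - {v}) = \<chi>"
      using assms by (auto simp: weighted_colourings_def PiE_iff extensional_def fun_eq_iff)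
    show "(\<lambda>\<chi>. restrict \<chi> (W - {v})) ` {\<chi> \<in> ?X. \<chi> u = \<chi> v} \<subseteq> ?Y"
    proof clarify
      fix \<chi> assume \<chi>: "\<chi> \<in> weighted_colourings W T" "\<chi> u = \<chi> v" "M = colouring_monom W w \<chi>"
      have "restrict \<chi> (W - {v}) (c x) = \<chi> x" if "x \<in> W" for x
        using that assms(3-5) \<chi>(2) by (auto simp: c_def)
      then have "restrict \<chi> (W - {v}) (c x) \<noteq> restrict \<chi> (W - {v}) (c y)" if "(x, y) \<in> T" for x y
        using \<chi>(1) T[OF that] that by (auto simp: weighted_colourings_def simp del: restrict_apply)
      then have "restrict \<chi> (W - {v}) \<in> weighted_colourings (W - {v}) (map_prod c c ` T)"
        by (auto simp: weighted_colourings_def simp del: restrict_apply)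
      moreover have "colouring_monom (W - {v}) ?w (restrict \<chi> (W - {v})) = colouring_monom W w \<chi>"
        unfolding mono[OF \<chi>(2)] by (rule colouring_monom_cong) auto
      ultimately show "restrict \<chi> (W - {v}) \<in> weighted_colourings (W - {v}) (map_prod c c ` T) \<and>
          colouring_monom (W - {v}) ?w (restrict \<chi> (W - {v})) = colouring_monom W w \<chi>" by simp
    qed
    show "(\<lambda>\<chi>. \<chi>(v := \<chi> u)) ` ?Y \<subseteq> {\<chi> \<in> ?X. \<chi> u = \<chi> v}"
    proof
      fix \<chi>' assume "\<chi>' \<in> (\<lambda>\<chi>. \<chi>(v := \<chi> u)) ` ?Y"
      then obtain \<chi> where \<chi>': "\<chi>' = \<chi>(v := \<chi> u)"
        and \<chi>: "\<chi> \<in> weighted_colourings (W - {v}) (map_prod c c ` T)"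
        and M: "colouring_monom (W - {v}) ?w \<chi> = M" by blast
      have "(\<chi>(v := \<chi> u)) x = \<chi> (c x)" for x by (simp add: c_def)
      moreover have "\<chi> (c x) \<noteq> \<chi> (c y)" if "(x, y) \<in> T" for x y
      proof -
        have "\<forall>(a, b)\<in>map_prod c c ` T. \<chi> a \<noteq> \<chi> b"
          using \<chi> unfolding weighted_colourings_def mem_Collect_eq by (rule conjunct2)
        from bspec[OF this imageI[OF that]] show ?thesis by simp
      qed
      ultimately have "(\<chi>(v := \<chi> u)) x \<noteq> (\<chi>(v := \<chi> u)) y" if "(x, y) \<in> T" for x y
        using that by (simp only: not_False_eq_True)
      moreover have "\<chi>(v := \<chi> u) \<in> W \<rightarrow>\<^sub>E UNIV"
        using \<chi> assms(4) by (auto simp: weighted_colourings_def PiE_iff extensional_def)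
      ultimately have "\<chi>(v := \<chi> u) \<in> weighted_colourings W T"
        unfolding weighted_colourings_def by blast
      moreover have "(\<chi>(v := \<chi> u)) u = (\<chi>(v := \<chi> u)) v" using assms(5) by simp
      moreover have "colouring_monom (W - {v}) ?w (\<chi>(v := \<chi> u)) = colouring_monom (W - {v}) ?w \<chi>"
        by (rule colouring_monom_cong) auto
      ultimately show "\<chi>' \<in> {\<chi> \<in> ?X. \<chi> u = \<chi> v}"
        unfolding \<chi>' using mono[of "\<chi>(v := \<chi> u)"] M by simp
    qed
  qed
  have "{\<chi> \<in> weighted_colourings W (insert (u, v) T). colouring_monom W w \<chi> = M} =
      ?X - {\<chi> \<in> ?X. \<chi> u = \<chi> v}"
    by (auto simp: weighted_colourings_def)
  moreover have "finite ?X" using assms by (intro finite_colourings_monom) auto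
  moreover have "{\<chi> \<in> ?X. \<chi> u = \<chi> v} \<subseteq> ?X" by blast
  ultimately have "int (card {\<chi> \<in> weighted_colourings W (insert (u, v) T). colouring_monom W w \<chi> = M}) =
      int (card ?X) - int (card {\<chi> \<in> ?X. \<chi> u = \<chi> v})"
    by (simp only: card_Diff_subset finite_subset card_mono of_nat_diff)
  then show "mcoeff (weighted_chromatic W w (insert (u, v) T)) M =
      mcoeff (weighted_chromatic W w T - weighted_chromatic (W - {v}) ?w (map_prod c c ` T)) M"
    unfolding bij_betw_same_card[OF bij] by (simp add: weighted_chromatic_def)
qed

text \<open>Both deletion and contraction leave fewer constraints; the induction ends at products of
  power sums, or at 0 when a loop is met.\<close>

lemma weighted_chromatic_specialisation:
  fixes \<epsilon> :: "nat \<Rightarrow> 'a::comm_ring_1"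
  assumes "finite T" "finite W" "T \<subseteq> W \<times> W" "\<And>v. v \<in> W \<Longrightarrow> 0 < w v" "\<epsilon> 0 = 1"
  shows "weighted_chromatic W w T \<in> Domain (specialisation \<epsilon>)"
  using assms(1-4)
proof (induction "card T" arbitrary: T W w rule: less_induct)
  case less
  show ?case
  proof (cases "T = {}")
    case True
    then show ?thesis
      using weighted_chromatic_no_constraint_specialisation[of W w \<epsilon>] less.prems assms(5) by simp
  next
    case False
    then obtain u v T' where T: "T = insert (u, v) T'" "(u, v) \<notin> T'"
      by (metis ex_in_conv mk_disjoint_insert surj_pair)
    then have T': "card T' < card T" "finite T'" "T' \<subseteq> W \<times> W" "u \<in> W" "v \<in> W"
      using less.prems by auto
    show ?thesis
    \<comment> \<open>Loops have to be treated even for loopless graphs, since contracting one of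
      two opposite or parallel pairs produces them.\<close>
    proof (cases "u = v")
      case True
      then have "weighted_chromatic W w T = 0"
        by (intro mpowser_eqI) (auto simp: weighted_chromatic_def weighted_colourings_def T)
      then show ?thesis by (auto intro: specialisation.zero)
    next
      case False
      let ?c = "\<lambda>x. if x = v then u else x"
      let ?T = "map_prod ?c ?c ` T'" and ?w = "w(u := w u + w v)"
      have "card ?T < card T"
        using T' card_image_le[of T' "map_prod ?c ?c"] by linarith
      then have "weighted_chromatic (W - {v}) ?w ?T \<in> Domain (specialisation \<epsilon>)"
      proof (rule less.hyps)
        show "?T \<subseteq> (W - {v}) \<times> (W - {v})" using T' False by (auto split: if_splits)
      qed (use T' less.prems in auto)
      then obtain r where r: "(weighted_chromatic (W - {v}) ?w ?T, r) \<in> specialisation \<epsilon>"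
        by auto
      obtain s where "(weighted_chromatic W w T', s) \<in> specialisation \<epsilon>"
        using less.hyps[OF T'(1,2) less.prems(2) T'(3)] less.prems(4) by auto
      from specialisation.add[OF this specialisation.uminus[OF r]] show ?thesis
        using weighted_chromatic_contract[OF less.prems(2) T'(3-5) False less.prems(4)]
        by (auto simp: T)
    qed
  qed
qed

section \<open>The chromatic symmetric function\<close>

lemma mcoeff_chromatic_sym:
  assumes "finite (verts G)"
  shows "mcoeff (chromatic_sym G) M =
    int (card {\<chi> \<in> proper_colorings G. image_mset \<chi> (mset_set (verts G)) = M})"
  unfolding chromatic_sym_def
  by (subst mcoeff_formal_sum_mmonom[OF prod_mvar[OF assms]]) simp

lemma finite_multigraph_edge:
  assumes "finite_multigraph G" "e \<in> edges G"
  obtains u v where "u \<in> verts G" "v \<in> verts G" "ends G e = {u, v}"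
  using assms by (auto simp: finite_multigraph_def)

lemma chromatic_sym_specialisation:
  fixes \<epsilon> :: "nat \<Rightarrow> 'a::comm_ring_1"
  assumes "finite_multigraph G" "\<epsilon> 0 = 1"
  shows "chromatic_sym G \<in> Domain (specialisation \<epsilon>)"
proof -
  \<comment> \<open>Every edge appears in both orders, parallel edges coincide, and a loop gives a
    pair \<open>(v, v)\<close>; the proper colourings are the same.\<close>
  let ?T = "{(u, v). \<exists>e\<in>edges G. ends G e = {u, v}}"
  have fin: "finite (verts G)" using assms(1) by (simp add: finite_multigraph_def)
  have T: "?T \<subseteq> verts G \<times> verts G"
    by clarify (metis assms(1) finite_multigraph_edge insertI1 insertI2 insert_iff singletonD SigmaI)
  have "proper_colorings G = weighted_colourings (verts G) ?T"
    by (auto simp: proper_colorings_def weighted_colourings_def)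
  moreover have "colouring_monom (verts G) (\<lambda>_. 1) \<chi> = image_mset \<chi> (mset_set (verts G))" for \<chi>
    using fin by induction (auto simp: colouring_monom_def)
  ultimately have "chromatic_sym G = weighted_chromatic (verts G) (\<lambda>_. 1) ?T"
    by (intro mpowser_eqI) (simp add: mcoeff_chromatic_sym fin weighted_chromatic_def)
  moreover have "finite ?T" using fin T by (rule_tac finite_subset) auto
  ultimately show ?thesis
    using weighted_chromatic_specialisation[of ?T "verts G" "\<lambda>_. 1" \<epsilon>] assms(2) fin T by simp
qed

section \<open>Coefficients in the elementary basis and evaluation\<close>

lemma finite_int_partitions: "finite (int_partitions n)"
proof (rule finite_subset)
  show "int_partitions n \<subseteq> (\<Union>k\<le>n. {p. set_mset p \<subseteq> {..n} \<and> size p = k})"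
  proof
    fix p assume p: "p \<in> int_partitions n"
    then have "x \<le> n" if "x \<in># p" for x
      using that by (auto simp: int_partitions_def dest: multi_member_split)
    moreover have "0 \<notin># q \<Longrightarrow> size q \<le> sum_mset q" for q :: "nat multiset"
      by (induction q) auto
    ultimately show "p \<in> (\<Union>k\<le>n. {p. set_mset p \<subseteq> {..n} \<and> size p = k})"
      using p by (auto simp: int_partitions_def)
  qed
  show "finite (\<Union>k\<le>n. {p. set_mset p \<subseteq> {..n} \<and> size p = k})"
    using finite_multisets_of_size[of "{..n}"] by (simp add: multisets_of_size_def conj_commute)
qed

text \<open>Justifies the definite description in \<open>elem_sym_coeff\<close>: an expansion exists
  by \<open>chromatic_sym_specialisation\<close>, homogeneity cuts it down to partitions of the
  right size, and linear independence makes it unique.\<close>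

lemma chromatic_coeff_expansion:
  assumes "finite_multigraph G"
  shows "chromatic_sym G =
    (\<Sum>p\<in>int_partitions (card (verts G)). of_int (chromatic_coeff G p) * elem_sym_part p)"
proof -
  let ?n = "card (verts G)"
  let ?P = "\<lambda>c. (\<forall>p. p \<notin> int_partitions ?n \<longrightarrow> c p = 0) \<and>
     chromatic_sym G = (\<Sum>p\<in>int_partitions ?n. of_int (c p) * elem_sym_part p)"
  have finv: "finite (verts G)" using assms by (simp add: finite_multigraph_def)
  obtain F c where F: "finite F" "\<And>p. p \<in> F \<Longrightarrow> 0 \<notin># p"
    "chromatic_sym G = (\<Sum>p\<in>F. of_int (c p) * elem_sym_part p)"
    using chromatic_sym_specialisation[OF assms, of "\<lambda>_. 1 :: int"]
    by (auto elim: specialisation_expand)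
  define d where "d p = (if p \<in> F \<inter> int_partitions ?n then c p else 0)" for p
  have "?P d"
  proof (intro conjI mpowser_eqI)
    fix M :: "nat multiset"
    show "mcoeff (chromatic_sym G) M =
        mcoeff (\<Sum>p\<in>int_partitions ?n. of_int (d p) * elem_sym_part p) M"
    proof (cases "size M = ?n")
      case True
      have "mcoeff (chromatic_sym G) M = (\<Sum>p\<in>F. c p * mcoeff (elem_sym_part p) M)"
        by (simp add: F(3) mcoeff_sum mcoeff_of_int_mult)
      also have "\<dots> = (\<Sum>p\<in>F \<inter> int_partitions ?n. c p * mcoeff (elem_sym_part p) M)"
        using True F(1,2) by (intro sum.mono_neutral_right)
          (auto simp: int_partitions_def intro: mcoeff_elem_sym_part_eq_0)
      also have "\<dots> = (\<Sum>p\<in>int_partitions ?n. d p * mcoeff (elem_sym_part p) M)"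
        by (intro sum.mono_neutral_cong_left finite_int_partitions) (auto simp: d_def)
      finally show ?thesis by (simp add: mcoeff_sum mcoeff_of_int_mult)
    next
      case False
      then have "{\<chi> \<in> proper_colorings G. image_mset \<chi> (mset_set (verts G)) = M} = {}" by auto
      then have "mcoeff (chromatic_sym G) M = 0"
        unfolding mcoeff_chromatic_sym[OF finv] by (simp only: card.empty of_nat_0)
      moreover have "mcoeff (elem_sym_part p) M = 0" if "p \<in> int_partitions ?n" for p
        using that False mcoeff_elem_sym_part_eq_0[of M p] by (auto simp: int_partitions_def)
      ultimately show ?thesis by (simp add: mcoeff_sum mcoeff_of_int_mult)
    qed
  qed (simp add: d_def)
  moreover have "c = c'" if "?P c" "?P c'" for c c'
  proof
    fix p
    have zero: "(\<Sum>p\<in>int_partitions ?n. of_int (c p - c' p) * elem_sym_part p) = 0"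
      using conjunct2[OF \<open>?P c\<close>] conjunct2[OF \<open>?P c'\<close>]
      by (simp add: left_diff_distrib sum_subtractf)
    have "c p - c' p = 0" if "p \<in> int_partitions ?n"
      by (rule elem_sym_part_independent[OF finite_int_partitions _ zero that])
        (simp add: int_partitions_def)
    moreover have "c p = 0" "c' p = 0" if "p \<notin> int_partitions ?n"
      using that \<open>?P c\<close> \<open>?P c'\<close> by blast+
    ultimately show "c p = c' p" by fastforce
  qed
  ultimately have "?P (THE c. ?P c)" by (intro theI[of ?P d]) blast+
  then show ?thesis unfolding chromatic_coeff_def elem_sym_coeff_def by (rule conjunct2)
qed

text \<open>The value P_G(e) of the overview, in any commutative ring; taking a polynomial ring
  supplies the formal parameter t.\<close>

definition chromatic_eval :: "(nat \<Rightarrow> 'a::comm_ring_1) \<Rightarrow> ('v, 'e) multigraph \<Rightarrow> 'a" where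
  "chromatic_eval \<epsilon> G =
    (\<Sum>p\<in>int_partitions (card (verts G)). of_int (chromatic_coeff G p) * (\<Prod>k\<in>#p. \<epsilon> k))"

lemma chromatic_eval_specialisation:
  assumes "finite_multigraph G"
  shows "(chromatic_sym G, chromatic_eval \<epsilon> G) \<in> specialisation \<epsilon>"
  unfolding chromatic_coeff_expansion[OF assms] chromatic_eval_def
  by (intro specialisation_sum specialisation_of_int_mult specialisation.part)
    (simp add: int_partitions_def)

section \<open>Stable sets as colour classes of a single variable\<close>

definition stable_sets :: "('v, 'e) multigraph \<Rightarrow> 'v set set" where
  "stable_sets G = {A. A \<subseteq> verts G \<and> (\<forall>e\<in>edges G. \<not> ends G e \<subseteq> A)}"

definition del_verts :: "('v, 'e) multigraph \<Rightarrow> 'v set \<Rightarrow> ('v, 'e) multigraph" where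
  "del_verts G A = \<lparr>verts = verts G - A, edges = {e \<in> edges G. ends G e \<inter> A = {}}, ends = ends G\<rparr>"

lemma verts_del_verts [simp]: "verts (del_verts G A) = verts G - A"
  and edges_del_verts [simp]: "edges (del_verts G A) = {e \<in> edges G. ends G e \<inter> A = {}}"
  and ends_del_verts [simp]: "ends (del_verts G A) = ends G"
  by (simp_all add: del_verts_def)

lemma finite_multigraph_del_verts: "finite_multigraph G \<Longrightarrow> finite_multigraph (del_verts G A)"
  by (fastforce simp: finite_multigraph_def)

lemma finite_stable_sets: "finite_multigraph G \<Longrightarrow> finite (stable_sets G)"
  by (rule finite_subset[of _ "Pow (verts G)"]) (auto simp: stable_sets_def finite_multigraph_def)

lemma first_var_coeff_chromatic_sym:
  assumes "finite_multigraph G"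
  shows "first_var_coeff j (chromatic_sym G) =
    (\<Sum>A | A \<in> stable_sets G \<and> card A = j. chromatic_sym (del_verts G A))"
proof (rule mpowser_eqI)
  fix M :: "nat multiset"
  let ?V = "verts G"
  have finv: "finite ?V" using assms by (simp add: finite_multigraph_def)
  let ?I = "{A. A \<in> stable_sets G \<and> card A = j}"
  let ?u = "image_mset Suc M + replicate_mset j 0"
  let ?L = "{\<chi> \<in> proper_colorings G. image_mset \<chi> (mset_set ?V) = ?u}"
  let ?R = "\<lambda>A. {\<chi> \<in> proper_colorings (del_verts G A). image_mset \<chi> (mset_set (?V - A)) = M}"
  \<comment> \<open>\<open>?f\<close> separates the class of colour 0 from the rest and lowers the
    other colours by one; \<open>?g\<close> is its inverse.\<close>
  let ?f = "\<lambda>\<chi>. ({v \<in> ?V. \<chi> v = 0}, \<lambda>v\<in>?V - {v \<in> ?V. \<chi> v = 0}. \<chi> v - 1)"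
  let ?g = "\<lambda>(A, \<chi>). \<lambda>v\<in>?V. if v \<in> A then 0 else Suc (\<chi> v)"
  have split: "image_mset \<chi> (mset_set ?V) =
      image_mset Suc (image_mset (\<lambda>v. \<chi> v - 1) (mset_set (?V - {v \<in> ?V. \<chi> v = 0}))) +
      replicate_mset (card {v \<in> ?V. \<chi> v = 0}) 0" for \<chi> :: "'a \<Rightarrow> nat"
  proof -
    let ?A = "{v \<in> ?V. \<chi> v = 0}"
    have "mset_set ?V = mset_set (?V - ?A) + mset_set ?A"
      using finv by (subst mset_set_Union[symmetric]) (auto intro!: arg_cong[of _ _ mset_set])
    moreover have "image_mset \<chi> (mset_set ?A) = image_mset (\<lambda>_. 0) (mset_set ?A)"
      using finv by (intro image_mset_cong) auto
    moreover have "image_mset Suc (image_mset (\<lambda>v. \<chi> v - 1) (mset_set (?V - ?A))) =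
        image_mset \<chi> (mset_set (?V - ?A))"
      unfolding multiset.map_comp using finv by (intro image_mset_cong) auto
    ultimately show ?thesis by (simp add: image_mset_const_eq)
  qed
  have bij: "bij_betw ?f ?L (SIGMA A:?I. ?R A)"
  proof (rule bij_betw_byWitness[where f' = ?g])
    show "\<forall>\<chi>\<in>?L. ?g (?f \<chi>) = \<chi>"
      by (auto simp: proper_colorings_def PiE_iff extensional_def fun_eq_iff)
    show zero: "\<forall>p\<in>SIGMA A:?I. ?R A. ?f (?g p) = p"
      by (auto simp: proper_colorings_def PiE_iff extensional_def fun_eq_iff stable_sets_def)
    show "?f ` ?L \<subseteq> (SIGMA A:?I. ?R A)"
    proof
      fix p assume "p \<in> ?f ` ?L"
      then obtain \<chi> where p: "p = ?f \<chi>" and \<chi>: "\<chi> \<in> proper_colorings G"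
        and img: "image_mset \<chi> (mset_set ?V) = ?u" by blast
      let ?A = "{v \<in> ?V. \<chi> v = 0}"
      have "image_mset (\<lambda>v. \<chi> v - 1) (mset_set (?V - ?A)) = M" "card ?A = j"
        using img unfolding split first_var_decomp_eq_iff by auto
      moreover have "image_mset (\<lambda>v\<in>?V - ?A. \<chi> v - 1) (mset_set (?V - ?A)) =
          image_mset (\<lambda>v. \<chi> v - 1) (mset_set (?V - ?A))"
        using finv by (intro image_mset_cong) auto
      moreover have "?A \<in> stable_sets G"
      proof -
        have "\<not> ends G e \<subseteq> ?A" if e: "e \<in> edges G" for e
        proof -
          obtain u v where "ends G e = {u, v}"
            using finite_multigraph_edge[OF assms e] by metis
          moreover from this have "\<chi> u \<noteq> \<chi> v" using \<chi> e by (auto simp: proper_colorings_def)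
          ultimately show ?thesis by auto
        qed
        then show ?thesis by (auto simp: stable_sets_def)
      qed
      moreover have "(\<lambda>v\<in>?V - ?A. \<chi> v - 1) \<in> proper_colorings (del_verts G ?A)"
      proof -
        have "(\<lambda>v\<in>?V - ?A. \<chi> v - 1) u \<noteq> (\<lambda>v\<in>?V - ?A. \<chi> v - 1) v"
          if "e \<in> edges G" "ends G e \<inter> ?A = {}" "ends G e = {u, v}" for e u v
        proof -
          have uv: "u \<in> ?V" "v \<in> ?V"
            using that finite_multigraph_edge[OF assms that(1)] by (metis insertCI insertE singletonD)+
          moreover have "\<chi> u \<noteq> \<chi> v" using \<chi> that by (auto simp: proper_colorings_def)
          ultimately show ?thesis using that(2,3) by auto
        qed
        moreover have "(\<lambda>v\<in>?V - ?A. \<chi> v - 1) \<in> (?V - ?A) \<rightarrow>\<^sub>E UNIV" by simp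
        ultimately show ?thesis
          unfolding proper_colorings_def edges_del_verts ends_del_verts verts_del_verts by blast
      qed
      ultimately show "p \<in> (SIGMA A:?I. ?R A)" unfolding p by simp
    qed
    show "?g ` (SIGMA A:?I. ?R A) \<subseteq> ?L"
    proof
      fix \<chi>' assume "\<chi>' \<in> ?g ` (SIGMA A:?I. ?R A)"
      then obtain A \<chi> where \<chi>': "\<chi>' = ?g (A, \<chi>)" and A: "A \<in> stable_sets G" "card A = j"
        and \<chi>: "\<chi> \<in> ?R A" by blast
      have 0: "{v \<in> ?V. \<chi>' v = 0} = A"
        using A by (auto simp: \<chi>' stable_sets_def)
      have "image_mset (\<lambda>v. \<chi>' v - 1) (mset_set (?V - A)) = image_mset \<chi> (mset_set (?V - A))"
        using finv by (intro image_mset_cong) (auto simp: \<chi>')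
      then have "image_mset \<chi>' (mset_set ?V) = ?u"
        using \<chi> A unfolding split[of \<chi>'] 0 by simp
      moreover have "\<chi>' \<in> proper_colorings G"
      proof -
        have "\<chi>' u \<noteq> \<chi>' v" if e: "e \<in> edges G" "ends G e = {u, v}" for e u v
        proof -
          have uv: "u \<in> ?V" "v \<in> ?V"
            using e finite_multigraph_edge[OF assms e(1)] by (metis insertCI insertE singletonD)+
          have "\<not> {u, v} \<subseteq> A" using A(1) e by (auto simp: stable_sets_def)
          moreover have "\<chi> u \<noteq> \<chi> v" if "{u, v} \<inter> A = {}"
            using \<chi> e that by (auto simp: proper_colorings_def)
          ultimately show ?thesis using uv by (auto simp: \<chi>')
        qed
        then show ?thesis by (auto simp: proper_colorings_def \<chi>')
      qed
      ultimately show "\<chi>' \<in> ?L" by simp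
    qed
  qed
  have finR: "finite (?R A)" for A
  proof (rule finite_subset)
    show "?R A \<subseteq> (?V - A) \<rightarrow>\<^sub>E set_mset M"
      using finv by (auto simp: proper_colorings_def PiE_iff extensional_def)
    show "finite ((?V - A) \<rightarrow>\<^sub>E set_mset M)" using finv by (intro finite_PiE) auto
  qed
  have finI: "finite ?I"
    by (rule finite_subset[OF _ finite_stable_sets[OF assms]]) auto
  have "mcoeff (first_var_coeff j (chromatic_sym G)) M = int (card ?L)"
    by (simp only: mcoeff_first_var_coeff mcoeff_chromatic_sym[OF finv])
  also have "card ?L = (\<Sum>A\<in>?I. card (?R A))"
    unfolding bij_betw_same_card[OF bij] using finI finR by (intro card_SigmaI) auto
  also have "int \<dots> = mcoeff (\<Sum>A\<in>?I. chromatic_sym (del_verts G A)) M"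
    using finv by (simp add: mcoeff_sum mcoeff_chromatic_sym)
  finally show "mcoeff (first_var_coeff j (chromatic_sym G)) M =
      mcoeff (\<Sum>A\<in>?I. chromatic_sym (del_verts G A)) M" .
qed

lemma chromatic_eval_add_variable:
  fixes \<epsilon> :: "nat \<Rightarrow> 'a::comm_ring_1"
  assumes "finite_multigraph G" "\<epsilon> 0 = 1"
  shows "chromatic_eval (\<lambda>k. \<epsilon> k + y * \<epsilon> (k - 1)) G =
    (\<Sum>A\<in>stable_sets G. y ^ card A * chromatic_eval \<epsilon> (del_verts G A))"
proof -
  \<comment> \<open>The new variable first stays an indeterminate, so that
    \<open>specialisation_unique\<close> can compare both sides for each size of \<open>A\<close>;
    only afterwards is \<open>y\<close> substituted.\<close>
  define q where "q = chromatic_eval (\<lambda>k. [:\<epsilon> k, \<epsilon> (k - 1):]) G"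
  have coeff: "coeff q j = (\<Sum>A | A \<in> stable_sets G \<and> card A = j. chromatic_eval \<epsilon> (del_verts G A))" for j
  proof (rule specialisation_unique)
    show "(first_var_coeff j (chromatic_sym G), coeff q j) \<in> specialisation \<epsilon>"
      unfolding q_def
      by (intro specialisation_first_var_coeff chromatic_eval_specialisation assms)
    show "(first_var_coeff j (chromatic_sym G),
        \<Sum>A | A \<in> stable_sets G \<and> card A = j. chromatic_eval \<epsilon> (del_verts G A)) \<in> specialisation \<epsilon>"
      unfolding first_var_coeff_chromatic_sym[OF assms(1)]
      by (intro specialisation_sum chromatic_eval_specialisation finite_multigraph_del_verts assms)
  qed
  define N where "N = max (degree q) (card (verts G))"
  have "card A \<le> N" if "A \<in> stable_sets G" for A
    using that assms(1) card_mono[of "verts G" A]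
    by (auto simp: stable_sets_def finite_multigraph_def N_def)
  then have N: "card ` stable_sets G \<subseteq> {..N}" by auto
  have "poly q y = (\<Sum>j\<le>N. coeff q j * y ^ j)"
    unfolding poly_altdef by (rule sum.mono_neutral_left) (auto simp: N_def coeff_eq_0)
  also have "\<dots> = (\<Sum>j\<le>N. \<Sum>A | A \<in> stable_sets G \<and> card A = j.
      y ^ card A * chromatic_eval \<epsilon> (del_verts G A))"
    by (simp add: coeff sum_distrib_left mult.commute)
  also have "\<dots> = (\<Sum>A\<in>stable_sets G. y ^ card A * chromatic_eval \<epsilon> (del_verts G A))"
    using N finite_stable_sets[OF assms(1)] by (intro sum.group) auto
  also have "poly q y = chromatic_eval (\<lambda>k. \<epsilon> k + y * \<epsilon> (k - 1)) G"
    by (simp add: q_def chromatic_eval_def poly_sum poly_prod_mset)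
  finally show ?thesis .
qed

section \<open>Acyclic orientations\<close>

definition reverse_orientation ::
    "('v, 'e) multigraph \<Rightarrow> ('e \<Rightarrow> 'v \<times> 'v) \<Rightarrow> 'e \<Rightarrow> 'v \<times> 'v" where
  "reverse_orientation G \<omega> = (\<lambda>e\<in>edges G. prod.swap (\<omega> e))"

context
  fixes G :: "('v, 'e) multigraph"
  assumes fin: "finite_multigraph G"
begin

lemma finite_verts: "finite (verts G)" and finite_edges: "finite (edges G)"
  using fin by (simp_all add: finite_multigraph_def)

lemma sources_iff: "v \<in> sources G \<omega> \<longleftrightarrow> v \<in> verts G \<and> (\<forall>e\<in>edges G. snd (\<omega> e) \<noteq> v)"
  using finite_edges by (auto simp: sources_def in_degree_def)

lemma sinks_iff: "v \<in> sinks G \<omega> \<longleftrightarrow> v \<in> verts G \<and> (\<forall>e\<in>edges G. fst (\<omega> e) \<noteq> v)"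
  using finite_edges by (auto simp: sinks_def out_degree_def)

lemma finite_sources: "finite (sources G \<omega>)"
  using finite_verts by (simp add: sources_def)

lemma finite_acyclic_orientations: "finite (acyclic_orientations G)"
proof (rule finite_subset)
  show "acyclic_orientations G \<subseteq> edges G \<rightarrow>\<^sub>E verts G \<times> verts G"
    by (auto simp: acyclic_orientations_def orientations_def)
  show "finite (edges G \<rightarrow>\<^sub>E verts G \<times> verts G)"
    using finite_edges finite_verts by (intro finite_PiE) auto
qed

lemma acyclic_orientation_edge:
  assumes "\<omega> \<in> acyclic_orientations G" "e \<in> edges G"
  shows "fst (\<omega> e) \<in> verts G" "snd (\<omega> e) \<in> verts G" "ends G e = {fst (\<omega> e), snd (\<omega> e)}"
    "fst (\<omega> e) \<noteq> snd (\<omega> e)"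
proof -
  show "fst (\<omega> e) \<in> verts G" "snd (\<omega> e) \<in> verts G" "ends G e = {fst (\<omega> e), snd (\<omega> e)}"
    using assms by (auto simp: acyclic_orientations_def orientations_def PiE_iff mem_Times_iff)
  show "fst (\<omega> e) \<noteq> snd (\<omega> e)"
  proof
    assume "fst (\<omega> e) = snd (\<omega> e)"
    then have "(fst (\<omega> e), fst (\<omega> e)) \<in> \<omega> ` edges G"
      using assms(2) by (metis image_eqI prod.collapse)
    then show False using assms(1) by (auto simp: acyclic_orientations_def acyclic_def)
  qed
qed

lemma sources_nonempty:
  assumes "\<omega> \<in> acyclic_orientations G" "verts G \<noteq> {}"
  shows "sources G \<omega> \<noteq> {}"
proof -
  have "wf (\<omega> ` edges G)"
    using assms(1) finite_edges by (intro finite_acyclic_wf) (auto simp: acyclic_orientations_def)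
  then obtain z where z: "z \<in> verts G" "\<And>y. (y, z) \<in> \<omega> ` edges G \<Longrightarrow> y \<notin> verts G"
    using assms(2) by (meson ex_in_conv wfE_min)
  have "snd (\<omega> e) \<noteq> z" if "e \<in> edges G" for e
    using z(2)[of "fst (\<omega> e)"] acyclic_orientation_edge(1)[OF assms(1) that] that
    by (metis image_eqI prod.collapse)
  then show ?thesis using z(1) sources_iff by blast
qed

lemma subset_sources_stable:
  assumes "\<omega> \<in> acyclic_orientations G" "A \<subseteq> sources G \<omega>"
  shows "A \<in> stable_sets G"
proof -
  have "\<not> ends G e \<subseteq> A" if "e \<in> edges G" for e
    using acyclic_orientation_edge(3)[OF assms(1) that] assms(2) that sources_iff by blast
  then show ?thesis using assms(2) by (auto simp: stable_sets_def sources_iff)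
qed

lemma source_is_tail:
  assumes "\<omega> \<in> acyclic_orientations G" "v \<in> sources G \<omega>" "e \<in> edges G" "v \<in> ends G e"
  shows "fst (\<omega> e) = v"
  using acyclic_orientation_edge(3)[OF assms(1,3)] assms(2-4) by (auto simp: sources_iff)

section \<open>Deleting and adding sets of sources\<close>

lemma restrict_acyclic_orientation:
  assumes "\<omega> \<in> acyclic_orientations G"
  shows "restrict \<omega> (edges (del_verts G A)) \<in> acyclic_orientations (del_verts G A)"
proof -
  let ?E = "edges (del_verts G A)"
  have "\<omega> e \<in> (verts G - A) \<times> (verts G - A)" if "e \<in> ?E" for e
    using acyclic_orientation_edge[OF assms, of e] that by (auto simp: mem_Times_iff)
  then have "restrict \<omega> ?E \<in> ?E \<rightarrow>\<^sub>E verts (del_verts G A) \<times> verts (del_verts G A)"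
    unfolding restrict_PiE_iff verts_del_verts by blast
  moreover have "{fst (\<omega> e), snd (\<omega> e)} = ends G e" if "e \<in> ?E" for e
    using acyclic_orientation_edge(3)[OF assms, of e] that by simp
  moreover have "acyclic (restrict \<omega> ?E ` ?E)"
    by (rule acyclic_subset[of "\<omega> ` edges G"])
      (use assms in \<open>auto simp: acyclic_orientations_def\<close>)
  ultimately show ?thesis by (simp add: acyclic_orientations_def orientations_def)
qed

text \<open>The deleted edges carry no information: each of them meets \<open>A\<close>, and its end
  there is a source and therefore its tail.\<close>

lemma inj_on_restrict_sources:
  "inj_on (\<lambda>\<omega>. restrict \<omega> (edges (del_verts G A))) {\<omega> \<in> acyclic_orientations G. A \<subseteq> sources G \<omega>}"
proof (rule inj_onI, rule ext)
  fix \<omega> \<omega>' e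
  assume \<omega>: "\<omega> \<in> {\<omega> \<in> acyclic_orientations G. A \<subseteq> sources G \<omega>}"
    and \<omega>': "\<omega>' \<in> {\<omega> \<in> acyclic_orientations G. A \<subseteq> sources G \<omega>}"
    and eq: "restrict \<omega> (edges (del_verts G A)) = restrict \<omega>' (edges (del_verts G A))"
  consider "e \<notin> edges G" | "e \<in> edges (del_verts G A)" | a where "e \<in> edges G" "a \<in> A" "a \<in> ends G e"
    by auto
  then show "\<omega> e = \<omega>' e"
  proof cases
    case 1
    then show ?thesis
      using \<omega> \<omega>' by (auto simp: acyclic_orientations_def orientations_def PiE_iff extensional_def)
  next
    case 2
    then show ?thesis using eq by (metis restrict_apply)
  next
    case 3
    then have "fst (\<omega> e) = a" "fst (\<omega>' e) = a" using \<omega> \<omega>' source_is_tail by blast+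
    moreover have "{fst (\<omega> e), snd (\<omega> e)} = {fst (\<omega>' e), snd (\<omega>' e)}"
      "fst (\<omega> e) \<noteq> snd (\<omega> e)" "fst (\<omega>' e) \<noteq> snd (\<omega>' e)"
      using \<omega> \<omega>' 3 acyclic_orientation_edge(3,4) by blast+
    ultimately show ?thesis by (metis doubleton_eq_iff prod_eq_iff)
  qed
qed

text \<open>No pair leads back into \<open>A\<close>, so a cycle would have to stay outside
  \<open>A\<close> and use \<open>r\<close> alone.\<close>

lemma acyclic_Un_from_outside:
  assumes "acyclic r" "r \<subseteq> (- A) \<times> (- A)" "R \<subseteq> A \<times> (- A)"
  shows "acyclic (r \<union> R)"
proof -
  have inv: "y \<notin> A \<and> (x \<notin> A \<longrightarrow> (x, y) \<in> r\<^sup>+)" if "(x, y) \<in> (r \<union> R)\<^sup>+" for x y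
    using that
  proof induction
    case (base y)
    then show ?case using assms(2,3) by auto
  next
    case (step y z)
    then have "(y, z) \<in> r" using assms(3) by auto
    then show ?case using step.IH assms(2) by (auto intro: trancl_into_trancl)
  qed
  show ?thesis
    unfolding acyclic_def using inv assms(1) by (meson acyclic_def)
qed

lemma restrict_sources_surj:
  assumes A: "A \<in> stable_sets G" and \<omega>': "\<omega>' \<in> acyclic_orientations (del_verts G A)"
  obtains \<omega> where "\<omega> \<in> acyclic_orientations G" "A \<subseteq> sources G \<omega>"
    "restrict \<omega> (edges (del_verts G A)) = \<omega>'"
proof -
  let ?E = "edges (del_verts G A)"
  \<comment> \<open>By stability an edge meeting \<open>A\<close> has exactly one end in
    \<open>A\<close>; the extension directs it away from that end.\<close>
  have "\<exists>p. fst p \<in> A \<and> snd p \<in> verts G - A \<and> ends G e = {fst p, snd p}"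
    if e: "e \<in> edges G" "e \<notin> ?E" for e
  proof -
    obtain u v where "u \<in> verts G" "v \<in> verts G" "ends G e = {u, v}"
      using finite_multigraph_edge[OF fin e(1)] by metis
    moreover have "\<not> {u, v} \<subseteq> A" using A e \<open>ends G e = {u, v}\<close> by (auto simp: stable_sets_def)
    moreover have "u \<in> A \<or> v \<in> A" using e \<open>ends G e = {u, v}\<close> by auto
    ultimately show ?thesis by (cases "u \<in> A") (auto intro: exI[of _ "(u, v)"] exI[of _ "(v, u)"])
  qed
  then obtain p where p: "\<And>e. e \<in> edges G \<Longrightarrow> e \<notin> ?E \<Longrightarrow>
      fst (p e) \<in> A \<and> snd (p e) \<in> verts G - A \<and> ends G e = {fst (p e), snd (p e)}"
    by metis
  define \<omega> where "\<omega> = (\<lambda>e\<in>edges G. if e \<in> ?E then \<omega>' e else p e)"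
  have AV: "A \<subseteq> verts G" using A by (simp add: stable_sets_def)
  have \<omega>'_edge: "\<omega>' e \<in> (verts G - A) \<times> (verts G - A)" "{fst (\<omega>' e), snd (\<omega>' e)} = ends G e"
    if "e \<in> ?E" for e
    using \<omega>' that by (auto simp: acyclic_orientations_def orientations_def PiE_iff)
  have edge: "\<omega> e \<in> verts G \<times> (verts G - A) \<and> {fst (\<omega> e), snd (\<omega> e)} = ends G e"
    if e: "e \<in> edges G" for e
  proof (cases "e \<in> ?E")
    case True
    then show ?thesis using \<omega>'_edge[OF True] e by (auto simp: \<omega>_def simp del: edges_del_verts)
  next
    case False
    then show ?thesis using p[OF e False] e AV
      by (auto simp: \<omega>_def mem_Times_iff simp del: edges_del_verts)
  qed
  have "\<omega> ` edges G \<subseteq> \<omega>' ` ?E \<union> p ` (edges G - ?E)"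
    by (auto simp: \<omega>_def simp del: edges_del_verts)
  moreover have "acyclic (\<omega>' ` ?E \<union> p ` (edges G - ?E))"
  proof (rule acyclic_Un_from_outside)
    show "acyclic (\<omega>' ` ?E)" using \<omega>' by (simp add: acyclic_orientations_def)
    show "\<omega>' ` ?E \<subseteq> (- A) \<times> (- A)" using \<omega>'_edge(1) by fastforce
    show "p ` (edges G - ?E) \<subseteq> A \<times> (- A)" using p unfolding image_subset_iff mem_Times_iff by blast
  qed
  ultimately have "acyclic (\<omega> ` edges G)" using acyclic_subset by blast
  moreover have "\<omega> \<in> edges G \<rightarrow>\<^sub>E verts G \<times> verts G"
    using edge by (auto simp: PiE_iff mem_Times_iff \<omega>_def extensional_def)
  ultimately have "\<omega> \<in> acyclic_orientations G"
    using edge by (simp add: acyclic_orientations_def orientations_def)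
  moreover have "A \<subseteq> sources G \<omega>"
    using edge AV by (fastforce simp: sources_iff mem_Times_iff)
  moreover have "restrict \<omega> ?E = \<omega>'"
  proof
    fix e
    show "restrict \<omega> ?E e = \<omega>' e"
      using \<omega>' by (auto simp: \<omega>_def acyclic_orientations_def orientations_def PiE_iff extensional_def)
  qed
  ultimately show thesis using that by blast
qed

lemma bij_betw_restrict_sources:
  assumes "A \<in> stable_sets G"
  shows "bij_betw (\<lambda>\<omega>. restrict \<omega> (edges (del_verts G A)))
    {\<omega> \<in> acyclic_orientations G. A \<subseteq> sources G \<omega>} (acyclic_orientations (del_verts G A))"
  unfolding bij_betw_def using inj_on_restrict_sources
proof (intro conjI equalityI subsetI)
  fix \<omega>' assume "\<omega>' \<in> acyclic_orientations (del_verts G A)"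
  then show "\<omega>' \<in> (\<lambda>\<omega>. restrict \<omega> (edges (del_verts G A))) `
      {\<omega> \<in> acyclic_orientations G. A \<subseteq> sources G \<omega>}"
    using restrict_sources_surj[OF assms, of \<omega>'] by (metis (mono_tags, lifting) image_eqI mem_Collect_eq)
qed (use restrict_acyclic_orientation in auto)

text \<open>An exchange of summation, with \<open>h\<close> and \<open>Z\<close> left general
  because it serves twice: with powers of \<open>y\<close> over all acyclic orientations, and with
  \<open>signed_tail\<close> over those with a unique sink.\<close>

lemma sum_stable_sets_sources:
  fixes h :: "nat \<Rightarrow> 'a::comm_ring_1"
  assumes "Z \<subseteq> acyclic_orientations G"
  shows "(\<Sum>A\<in>stable_sets G. h (card A) * of_nat (card {\<omega> \<in> Z. A \<subseteq> sources G \<omega>})) =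
    (\<Sum>\<omega>\<in>Z. \<Sum>A\<in>Pow (sources G \<omega>). h (card A))"
proof -
  have finZ: "finite Z" using assms finite_acyclic_orientations finite_subset by blast
  have "(\<Sum>A\<in>stable_sets G. h (card A) * of_nat (card {\<omega> \<in> Z. A \<subseteq> sources G \<omega>})) =
      (\<Sum>A\<in>stable_sets G. \<Sum>\<omega>\<in>Z. if A \<subseteq> sources G \<omega> then h (card A) else 0)"
    using finZ by (intro sum.cong) (auto simp: mult.commute simp flip: sum.inter_filter)
  also have "\<dots> = (\<Sum>\<omega>\<in>Z. \<Sum>A\<in>stable_sets G. if A \<subseteq> sources G \<omega> then h (card A) else 0)"
    by (rule sum.swap)
  also have "\<dots> = (\<Sum>\<omega>\<in>Z. \<Sum>A\<in>Pow (sources G \<omega>). h (card A))"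
  proof (rule sum.cong[OF refl])
    fix \<omega> assume "\<omega> \<in> Z"
    then have "{A \<in> stable_sets G. A \<subseteq> sources G \<omega>} = Pow (sources G \<omega>)"
      using assms subset_sources_stable by blast
    then show "(\<Sum>A\<in>stable_sets G. if A \<subseteq> sources G \<omega> then h (card A) else 0) =
        (\<Sum>A\<in>Pow (sources G \<omega>). h (card A))"
      using finite_stable_sets[OF fin] by (simp flip: sum.inter_filter)
  qed
  finally show ?thesis .
qed

lemma sum_stable_sets_acyclic_orientations:
  fixes y :: "'a::comm_ring_1"
  shows "(\<Sum>A\<in>stable_sets G. y ^ card A * of_nat (card (acyclic_orientations (del_verts G A)))) =
    (\<Sum>\<omega>\<in>acyclic_orientations G. (1 + y) ^ card (sources G \<omega>))"
proof -
  have "(\<Sum>A\<in>stable_sets G. y ^ card A * of_nat (card (acyclic_orientations (del_verts G A)))) =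
      (\<Sum>\<omega>\<in>acyclic_orientations G. \<Sum>A\<in>Pow (sources G \<omega>). y ^ card A)"
    unfolding sum_stable_sets_sources[OF order_refl, symmetric]
    by (intro sum.cong refl) (simp add: bij_betw_same_card[OF bij_betw_restrict_sources])
  moreover have "(\<Sum>A\<in>Pow S. y ^ card A) = (1 + y) ^ card S" if "finite S" for S :: "'v set"
    using prod_add[OF that, of "\<lambda>_. y" "\<lambda>_. 1"] by (simp add: add.commute)
  ultimately show ?thesis using finite_sources by simp
qed

lemma reverse_acyclic_orientation:
  assumes "\<omega> \<in> acyclic_orientations G"
  shows "reverse_orientation G \<omega> \<in> acyclic_orientations G"
    and "reverse_orientation G (reverse_orientation G \<omega>) = \<omega>"
    and "sources G (reverse_orientation G \<omega>) = sinks G \<omega>"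
proof -
  have "reverse_orientation G \<omega> ` edges G = (\<omega> ` edges G)\<inverse>"
    by (auto simp: reverse_orientation_def image_iff prod.swap_def) (metis fst_conv snd_conv)+
  then have "acyclic (reverse_orientation G \<omega> ` edges G)"
    using assms by (simp add: acyclic_orientations_def)
  then show "reverse_orientation G \<omega> \<in> acyclic_orientations G"
    using assms by (auto simp: acyclic_orientations_def orientations_def PiE_iff mem_Times_iff
        reverse_orientation_def insert_commute)
  show "reverse_orientation G (reverse_orientation G \<omega>) = \<omega>"
    using assms by (auto simp: fun_eq_iff acyclic_orientations_def orientations_def PiE_iff
        reverse_orientation_def extensional_def)
  show "sources G (reverse_orientation G \<omega>) = sinks G \<omega>"
    by (auto simp: sources_iff sinks_iff reverse_orientation_def)
qed

text \<open>Colour classes get removed as sets of sources, whereas the linear coefficient is to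
  count sinks. Reversing all edges trades one for the other.\<close>

lemma sum_sources_eq_sum_sinks:
  "(\<Sum>\<omega>\<in>acyclic_orientations G. h (sources G \<omega>)) =
    (\<Sum>\<omega>\<in>acyclic_orientations G. h (sinks G \<omega>))"
  by (rule sum.reindex_bij_witness[where i = "reverse_orientation G" and j = "reverse_orientation G"])
    (metis reverse_acyclic_orientation)+

lemma unique_sink_iff:
  "\<omega> \<in> unique_sink_orientations G \<longleftrightarrow> \<omega> \<in> acyclic_orientations G \<and> card (sinks G \<omega>) = 1"
proof -
  have "(\<exists>!v. v \<in> S) \<longleftrightarrow> (\<exists>v. S = {v})" for S :: "'v set" by auto
  then show ?thesis by (simp add: unique_sink_orientations_def card_1_singleton_iff)
qed

context
  assumes no_isolated: "\<nexists>v. isolated G v"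
begin

text \<open>Deleting sources removes only edges with tail in \<open>A\<close>, so no out-degree
  outside \<open>A\<close> changes; and no sink is lost, since a non-isolated source has an outgoing
  edge.\<close>

lemma sinks_restrict_sources:
  assumes "\<omega> \<in> acyclic_orientations G" "A \<subseteq> sources G \<omega>"
  shows "v \<in> verts G - A \<and> (\<forall>e\<in>edges (del_verts G A). fst (restrict \<omega> (edges (del_verts G A)) e) \<noteq> v)
    \<longleftrightarrow> v \<in> sinks G \<omega>"
proof
  assume v: "v \<in> verts G - A \<and>
    (\<forall>e\<in>edges (del_verts G A). fst (restrict \<omega> (edges (del_verts G A)) e) \<noteq> v)"
  have "fst (\<omega> e) \<noteq> v" if e: "e \<in> edges G" for e
  proof (cases "ends G e \<inter> A = {}")
    case False
    then show ?thesis using source_is_tail[OF assms(1)] assms(2) e v by fastforce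
  qed (use v e in auto)
  then show "v \<in> sinks G \<omega>" using v by (simp add: sinks_iff)
next
  assume v: "v \<in> sinks G \<omega>"
  \<comment> \<open>The absence of isolated vertices enters here: if \<open>v\<close> were in
    \<open>A\<close>, this edge would have to leave it.\<close>
  moreover obtain e where "e \<in> edges G" "v \<in> ends G e"
    using v no_isolated by (auto simp: isolated_def sinks_def)
  ultimately have "v \<notin> A" using source_is_tail[OF assms(1)] assms(2) sinks_iff by blast
  then show "v \<in> verts G - A \<and>
      (\<forall>e\<in>edges (del_verts G A). fst (restrict \<omega> (edges (del_verts G A)) e) \<noteq> v)"
    using v by (simp add: sinks_iff)
qed

lemma sinks_not_sources:
  assumes "\<omega> \<in> acyclic_orientations G" "v \<in> sinks G \<omega>"
  shows "v \<notin> sources G \<omega>"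
  \<comment> \<open>The instance where \<open>A\<close> consists of all sources.\<close>
  using sinks_restrict_sources[OF assms(1) order_refl] assms(2) by blast

end

end

lemma bij_betw_restrict_sources_unique_sink:
  assumes "finite_multigraph G" "\<nexists>v. isolated G v" "A \<in> stable_sets G"
  shows "bij_betw (\<lambda>\<omega>. restrict \<omega> (edges (del_verts G A)))
    {\<omega> \<in> unique_sink_orientations G. A \<subseteq> sources G \<omega>} (unique_sink_orientations (del_verts G A))"
proof -
  have "sinks (del_verts G A) (restrict \<omega> (edges (del_verts G A))) = sinks G \<omega>"
    if "\<omega> \<in> acyclic_orientations G" "A \<subseteq> sources G \<omega>" for \<omega>
    using sinks_restrict_sources[OF assms(1,2) that]
      sinks_iff[OF finite_multigraph_del_verts[OF assms(1)]]
    by (metis (no_types, lifting) subsetI subset_antisym verts_del_verts)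
  then have "bij_betw (\<lambda>\<omega>. restrict \<omega> (edges (del_verts G A)))
      {\<omega> \<in> {\<omega> \<in> acyclic_orientations G. A \<subseteq> sources G \<omega>}. \<exists>!v. v \<in> sinks G \<omega>}
      {\<omega> \<in> acyclic_orientations (del_verts G A). \<exists>!v. v \<in> sinks (del_verts G A) \<omega>}"
    by (intro bij_betw_Collect[OF bij_betw_restrict_sources[OF assms(1,3)]])
      (simp del: edges_del_verts)
  moreover have "{\<omega> \<in> {\<omega> \<in> acyclic_orientations G. A \<subseteq> sources G \<omega>}. \<exists>!v. v \<in> sinks G \<omega>} =
      {\<omega> \<in> unique_sink_orientations G. A \<subseteq> sources G \<omega>}"
    by (auto simp: unique_sink_orientations_def)
  ultimately show ?thesis by (simp only: unique_sink_orientations_def)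
qed

section \<open>Coefficients of hook partitions\<close>

text \<open>Since parts are positive, the value at 0 may be changed freely. This reconciles the
  normalisation \<open>\<epsilon> 0 = 1\<close> with values that are all multiples of t.\<close>

lemma chromatic_eval_cong:
  assumes "\<And>k. 0 < k \<Longrightarrow> \<epsilon> k = \<epsilon>' k"
  shows "chromatic_eval \<epsilon> G = chromatic_eval \<epsilon>' G"
proof -
  have "image_mset \<epsilon> p = image_mset \<epsilon>' p" if "p \<in> int_partitions n" for p n
    using that by (intro image_mset_cong assms) (metis (mono_tags) gr0I int_partitions_def mem_Collect_eq)
  then show ?thesis by (simp add: chromatic_eval_def)
qed

lemma chromatic_eval_0:
  assumes "finite_multigraph G" "verts G \<noteq> {}" "\<And>k. 0 < k \<Longrightarrow> \<epsilon> k = 0"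
  shows "chromatic_eval \<epsilon> G = 0"
proof -
  have "card (verts G) \<noteq> 0" using assms(1,2) by (simp add: finite_multigraph_def)
  then have "(\<Prod>k\<in>#p. \<epsilon> k) = 0" if "p \<in> int_partitions (card (verts G))" for p
    using that assms(3) by (cases p) (auto simp: int_partitions_def)
  then show ?thesis by (simp add: chromatic_eval_def)
qed

lemma no_edges_if_no_verts:
  assumes "finite_multigraph G" "verts G = {}"
  shows "edges G = {}"
  using assms by (auto simp: finite_multigraph_def)

lemma chromatic_eval_no_verts:
  fixes \<epsilon> :: "nat \<Rightarrow> 'a::comm_ring_1"
  assumes "finite_multigraph G" "verts G = {}"
  shows "chromatic_eval \<epsilon> G = 1"
proof -
  have "chromatic_sym G = 1"
  proof (rule mpowser_eqI)
    fix M
    have "{\<chi> \<in> proper_colorings G. image_mset \<chi> (mset_set (verts G)) = M} =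
        (if M = {#} then {\<lambda>_. undefined} else {})"
      using assms by (auto simp: proper_colorings_def no_edges_if_no_verts)
    then show "mcoeff (chromatic_sym G) M = mcoeff 1 M"
      by (simp add: mcoeff_chromatic_sym assms(2)[THEN arg_cong, of finite] mcoeff_one)
  qed
  then show ?thesis
    using specialisation_unique chromatic_eval_specialisation[OF assms(1), of \<epsilon>] specialisation_one
    by metis
qed

lemma empty_stable: "finite_multigraph G \<Longrightarrow> {} \<in> stable_sets G"
  by (auto simp: stable_sets_def finite_multigraph_def)

lemma del_verts_empty: "del_verts G {} = G"
  by (simp add: del_verts_def)

section \<open>Counting acyclic orientations by evaluation\<close>

lemma chromatic_eval_1:
  assumes "finite_multigraph G"
  shows "chromatic_eval (\<lambda>_. 1) G = (of_nat (card (acyclic_orientations G)) :: 'a::comm_ring_1)"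
  using assms
proof (induction "card (verts G)" arbitrary: G rule: less_induct)
  case less
  show ?case
  proof (cases "verts G = {}")
    case True
    then have "acyclic_orientations G = {\<lambda>_. undefined}"
      using no_edges_if_no_verts[OF less.prems True]
      by (auto simp: acyclic_orientations_def orientations_def acyclic_def)
    then show ?thesis using chromatic_eval_no_verts[OF less.prems True] by simp
  next
    case False
    let ?S = "stable_sets G"
    let ?a = "\<lambda>A. of_nat (card (acyclic_orientations (del_verts G A))) :: 'a"
    have finV: "finite (verts G)" using less.prems by (simp add: finite_multigraph_def)
    have IH: "chromatic_eval (\<lambda>_. 1) (del_verts G A) = ?a A" if "A \<in> ?S - {{}}" for A
    proof (rule less.hyps)
      show "card (verts (del_verts G A)) < card (verts G)"
        using that finV by (auto simp: stable_sets_def intro!: psubset_card_mono)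
    qed (rule finite_multigraph_del_verts[OF less.prems])
    \<comment> \<open>With \<open>y = -1\<close> all values cancel to 0, while on the orientation
      side every term vanishes because there is always a source. The two alternating sums agree term
      by term for nonempty \<open>A\<close> by induction, hence also at \<open>A = {}\<close>, which
      is \<open>G\<close> itself.\<close>
    have "(\<Sum>A\<in>?S. (- 1) ^ card A * chromatic_eval (\<lambda>_. 1) (del_verts G A)) =
        chromatic_eval (\<lambda>k. 1 + (- 1) * 1) G"
      by (rule chromatic_eval_add_variable[OF less.prems, symmetric]) simp
    also have "\<dots> = (0 :: 'a)" by (rule chromatic_eval_0[OF less.prems False]) simp
    also have "0 = (\<Sum>\<omega>\<in>acyclic_orientations G. (1 + (- 1 :: 'a)) ^ card (sources G \<omega>))"
      using sources_nonempty[OF less.prems _ False] finite_sources[OF less.prems]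
      by (intro sum.neutral[symmetric]) (simp add: card_gt_0_iff power_0_left)
    also have "\<dots> = (\<Sum>A\<in>?S. (- 1) ^ card A * ?a A)"
      by (rule sum_stable_sets_acyclic_orientations[OF less.prems, symmetric])
    finally have "chromatic_eval (\<lambda>_. 1) (del_verts G {}) = ?a {}"
      using IH
      by (simp add: sum.remove[OF finite_stable_sets[OF less.prems] empty_stable[OF less.prems]])
    then show ?thesis by (simp add: del_verts_empty)
  qed
qed

text \<open>Stanley's theorem on sinks: for an indeterminate \<open>t\<close> the left side groups
  the coefficients by the number of parts.\<close>

lemma chromatic_eval_const:
  fixes t :: "'a::comm_ring_1"
  assumes "finite_multigraph G"
  shows "chromatic_eval (\<lambda>_. t) G = (\<Sum>\<omega>\<in>acyclic_orientations G. t ^ card (sinks G \<omega>))"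
proof -
  have "chromatic_eval (\<lambda>_. t) G = chromatic_eval (\<lambda>k. 1 + (t - 1) * 1) G" by simp
  also have "\<dots> = (\<Sum>A\<in>stable_sets G. (t - 1) ^ card A * chromatic_eval (\<lambda>_. 1) (del_verts G A))"
    by (rule chromatic_eval_add_variable[OF assms]) simp
  also have "\<dots> = (\<Sum>\<omega>\<in>acyclic_orientations G. (1 + (t - 1)) ^ card (sources G \<omega>))"
    unfolding sum_stable_sets_acyclic_orientations[OF assms, symmetric]
    by (simp add: chromatic_eval_1 finite_multigraph_del_verts assms)
  finally show ?thesis
    using sum_sources_eq_sum_sinks[OF assms, of "\<lambda>S. t ^ card S"] by simp
qed

lemma prod_mset_monom: fixes u :: "'i \<Rightarrow> 'a::comm_ring_1" shows "(\<Prod>k\<in>#p. monom (u k) 1) = monom (\<Prod>k\<in>#p. u k) (size p)"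
proof (induction p)
  case empty show ?case by simp
next
  case (add k p)
  have "(\<Prod>k\<in>#add_mset k p. monom (u k) 1) = monom (u k) 1 * monom (\<Prod>k\<in>#p. u k) (size p)"
    using add.IH by simp
  then show ?case by (simp add: mult_monom)
qed

lemma coeff_of_int_mult: "coeff (of_int c * q) i = of_int c * coeff q i"
  by (simp only: of_int_poly mult_pCons_left) simp

text \<open>A partition with r parts contributes in degree r of the indeterminate, so only the
  partition with one part reaches the linear coefficient.\<close>

lemma coeff_1_chromatic_eval_monom:
  assumes "finite_multigraph G" "verts G \<noteq> {}"
  shows "coeff (chromatic_eval (\<lambda>k. monom (u k) 1) G) 1 =
    of_int (chromatic_coeff G {#card (verts G)#}) * u (card (verts G))"
proof -
  let ?n = "card (verts G)"
  have n: "0 < ?n" using assms by (simp add: finite_multigraph_def card_gt_0_iff)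
  have "coeff (chromatic_eval (\<lambda>k. monom (u k) 1) G) 1 =
      (\<Sum>p\<in>int_partitions ?n. of_int (chromatic_coeff G p) *
        (if size p = 1 then \<Prod>k\<in>#p. u k else 0))"
    unfolding chromatic_eval_def prod_mset_monom coeff_sum coeff_of_int_mult by simp
  also have "\<dots> = (\<Sum>p\<in>{{#?n#}}. of_int (chromatic_coeff G p) * (\<Prod>k\<in>#p. u k))"
  proof (intro sum.mono_neutral_cong_right finite_int_partitions ballI)
    fix p assume "p \<in> int_partitions ?n - {{#?n#}}"
    moreover have "p = {#?n#}" if "size p = 1" "p \<in> int_partitions ?n"
      using size_1_singleton_mset[OF that(1)] that(2) by (auto simp: int_partitions_def)
    ultimately show "of_int (chromatic_coeff G p) * (if size p = 1 then \<Prod>k\<in>#p. u k else 0) = 0"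
      by auto
  qed (use n in \<open>auto simp: int_partitions_def\<close>)
  finally show ?thesis by simp
qed

lemma chromatic_coeff_one_part:
  assumes "finite_multigraph G" "verts G \<noteq> {}"
  shows "chromatic_coeff G {#card (verts G)#} = int (card (unique_sink_orientations G))"
proof -
  let ?Z = "unique_sink_orientations G"
  have "chromatic_coeff G {#card (verts G)#} =
      coeff (chromatic_eval (\<lambda>_. monom (1 :: int) 1) G) 1"
    using coeff_1_chromatic_eval_monom[OF assms, of "\<lambda>_. 1 :: int"] by simp
  also have "\<dots> = (\<Sum>\<omega>\<in>acyclic_orientations G. if card (sinks G \<omega>) = 1 then 1 else 0)"
    unfolding chromatic_eval_const[OF assms(1)] coeff_sum
    by (intro sum.cong) (simp_all add: monom_power)
  also have "\<dots> = (\<Sum>\<omega>\<in>?Z. 1)"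
    using finite_acyclic_orientations[OF assms(1)]
    by (intro sum.mono_neutral_cong_right) (auto simp: unique_sink_iff[OF assms(1)])
  finally show ?thesis by simp
qed

text \<open>
  Adding one variable with value 1 to the virtual alphabet with elementary symmetric functions
  \<open>signed_tail m k\<close> leaves only the \<open>m\<close>-th one.
\<close>

definition signed_tail :: "nat \<Rightarrow> nat \<Rightarrow> int" where
  "signed_tail m k = (if m \<le> k then (- 1) ^ (k - m) else 0)"

lemma signed_tail_add:
  assumes "0 < m" "0 < k"
  shows "signed_tail m k + signed_tail m (k - 1) = (if k = m then 1 else 0)"
proof -
  have "Suc (k - Suc m) = k - m" if "m < k" using that by simp
  then have "(- 1 :: int) ^ (k - m) = - ((- 1) ^ (k - Suc m))" if "m < k"
    using that by (metis mult_minus1 power_Suc)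
  then show ?thesis
    using assms by (auto simp: signed_tail_def not_le)
qed

text \<open>Fix \<open>x\<close> in \<open>S\<close> and pair each \<open>A\<close> avoiding
  \<open>x\<close> with \<open>insert x A\<close>. By \<open>signed_tail_add\<close> a pair sums to
  1 if \<open>card A = n - m\<close> and to 0 otherwise, so the subsets of \<open>S - {x}\<close> of
  that size are counted; the fixed element is the 1 subtracted in the binomial coefficient.\<close>

lemma sum_Pow_signed_tail:
  assumes "finite S" "S \<noteq> {}" "card S \<le> n" "0 < m" "m \<le> n"
  shows "(\<Sum>A\<in>Pow S. signed_tail m (n - card A)) = int ((card S - 1) choose (n - m))"
proof -
  obtain x S' where S: "S = insert x S'" "x \<notin> S'" using assms(2) by (meson ex_in_conv mk_disjoint_insert)
  have fin: "finite S'" using assms S by simp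
  have card: "card (insert x A) = Suc (card A)" "card A < n" if "A \<in> Pow S'" for A
  proof -
    have "finite A" "x \<notin> A" "card A \<le> card S'"
      using that S(2) fin by (auto intro: finite_subset card_mono)
    then show "card (insert x A) = Suc (card A)" "card A < n"
      using assms(3) S fin by auto
  qed
  have "(\<Sum>A\<in>Pow S. signed_tail m (n - card A)) =
      (\<Sum>A\<in>Pow S'. signed_tail m (n - card A)) + (\<Sum>A\<in>insert x ` Pow S'. signed_tail m (n - card A))"
    unfolding S(1) Pow_insert using fin S(2) by (intro sum.union_disjoint) auto
  also have "(\<Sum>A\<in>insert x ` Pow S'. signed_tail m (n - card A)) =
      (\<Sum>A\<in>Pow S'. signed_tail m (n - card A - 1))"
    using S(2) by (subst sum.reindex) (auto simp: inj_on_def card intro!: sum.cong)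
  also have "(\<Sum>A\<in>Pow S'. signed_tail m (n - card A)) + \<dots> =
      (\<Sum>A\<in>Pow S'. if card A = n - m then 1 else 0)"
    unfolding sum.distrib[symmetric]
  proof (rule sum.cong[OF refl])
    fix A assume "A \<in> Pow S'"
    then have "card A < n" by (rule card)
    then show "signed_tail m (n - card A) + signed_tail m (n - card A - 1) =
        (if card A = n - m then 1 else 0)"
      using assms(4,5) by (subst signed_tail_add) auto
  qed
  also have "\<dots> = int (card {A. A \<subseteq> S' \<and> card A = n - m})"
    using fin by (simp add: sum.If_cases Int_def)
  also have "\<dots> = int ((card S - 1) choose (n - m))"
    using S fin by (simp add: n_subsets)
  finally show ?thesis .
qed

lemma hook_partition_iff:
  assumes "2 \<le> m" "m \<le> n"
  shows "p \<in> int_partitions n \<and> set_mset p \<subseteq> {1, m} \<and> count p m = 1 \<longleftrightarrow>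
    p = {#m#} + replicate_mset (n - m) 1"
proof (intro iffI; (elim conjE)?)
  assume p: "p \<in> int_partitions n" "set_mset p \<subseteq> {1, m}" "count p m = 1"
  then obtain q where q: "p = add_mset m q"
    by (metis count_inI insert_DiffM zero_neq_one)
  then have "m \<notin># q" using p(3) by (simp add: not_in_iff)
  then have "set_mset q \<subseteq> {1}" using p(2) q by auto
  then have "q = replicate_mset (size q) 1" by (rule set_mset_subset_singletonD)
  moreover have "sum_mset q = size q" using \<open>set_mset q \<subseteq> {1}\<close> by (induction q) auto
  moreover have "m + sum_mset q = n" using p(1) q by (simp add: int_partitions_def)
  ultimately show "p = {#m#} + replicate_mset (n - m) 1" by (simp add: q) (metis add_diff_cancel_left')
qed (use assms in \<open>auto simp: int_partitions_def split: if_splits\<close>)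

lemma chromatic_coeff_hook:
  assumes "finite_multigraph G" "2 \<le> m" "m \<le> card (verts G)"
  shows "chromatic_coeff G ({#m#} + replicate_mset (card (verts G) - m) 1) =
    (\<Sum>A\<in>stable_sets G. signed_tail m (card (verts G) - card A) *
      int (card (unique_sink_orientations (del_verts G A))))"
proof -
  let ?n = "card (verts G)"
  \<comment> \<open>The value 1 at index 0 is what \<open>chromatic_eval_add_variable\<close>
    requires; all other values are multiples of the indeterminate, which stands for t.\<close>
  define \<epsilon> where "\<epsilon> k = (if k = 0 then 1 else monom (signed_tail m k) 1)" for k
  \<comment> \<open>At \<open>k = 1\<close> the 1 comes from \<open>\<epsilon> 0\<close>, and
    \<open>m \<ge> 2\<close> is needed for \<open>\<epsilon> 1 = 0\<close>.\<close>
  have \<epsilon>: "\<epsilon> k + 1 * \<epsilon> (k - 1) = (if k = 1 then 1 else if k = m then monom 1 1 else 0)" if "0 < k" for k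
  proof (cases "k = 1")
    case True
    then show ?thesis using assms(2) by (simp add: \<epsilon>_def signed_tail_def)
  next
    case False
    then have "\<epsilon> k + 1 * \<epsilon> (k - 1) = monom (signed_tail m k + signed_tail m (k - 1)) 1"
      using that by (simp add: \<epsilon>_def add_monom)
    then show ?thesis using False that assms(2) signed_tail_add[of m k] by simp
  qed
  have prod: "(\<Prod>k\<in>#p. if k = 1 then 1 else if k = m then monom 1 1 else 0) =
      (if set_mset p \<subseteq> {1, m} then monom (1 :: int) (count p m) else 0)" for p
    using assms(2) by (induction p) (auto simp: mult_monom)
  have "chromatic_coeff G ({#m#} + replicate_mset (?n - m) 1) =
      (\<Sum>p\<in>{{#m#} + replicate_mset (?n - m) 1}. chromatic_coeff G p)" by simp
  also have "\<dots> = (\<Sum>p\<in>int_partitions ?n.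
      chromatic_coeff G p * (if set_mset p \<subseteq> {1, m} \<and> count p m = 1 then 1 else 0))"
    using hook_partition_iff[of m ?n] assms(2,3)
    by (intro sum.mono_neutral_cong_left finite_int_partitions) auto
  \<comment> \<open>The exponent of the indeterminate is the multiplicity of \<open>m\<close>, so
    the linear coefficient demands exactly one part \<open>m\<close>.\<close>
  also have "\<dots> = coeff (chromatic_eval (\<lambda>k. if k = 1 then 1 else if k = m then monom 1 1 else 0) G) 1"
    unfolding chromatic_eval_def prod coeff_sum coeff_of_int_mult
    by (intro sum.cong) auto
  also have "chromatic_eval (\<lambda>k. if k = 1 then 1 else if k = m then monom 1 1 else 0) G =
      chromatic_eval (\<lambda>k. \<epsilon> k + 1 * \<epsilon> (k - 1)) G"
    by (rule chromatic_eval_cong) (simp only: \<epsilon>)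
  also have "coeff \<dots> 1 = (\<Sum>A\<in>stable_sets G. coeff (chromatic_eval \<epsilon> (del_verts G A)) 1)"
    by (subst chromatic_eval_add_variable[OF assms(1)]) (simp_all add: \<epsilon>_def coeff_sum)
  also have "\<dots> = (\<Sum>A\<in>stable_sets G. signed_tail m (?n - card A) *
      int (card (unique_sink_orientations (del_verts G A))))"
  proof (rule sum.cong[OF refl])
    fix A assume A: "A \<in> stable_sets G"
    let ?H = "del_verts G A"
    have H: "finite_multigraph ?H" using assms(1) by (rule finite_multigraph_del_verts)
    have card: "card (verts ?H) = ?n - card A"
      using A assms(1) by (auto simp: stable_sets_def finite_multigraph_def intro!: card_Diff_subset
          intro: finite_subset)
    show "coeff (chromatic_eval \<epsilon> ?H) 1 =
        signed_tail m (?n - card A) * int (card (unique_sink_orientations ?H))"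
    \<comment> \<open>If \<open>A\<close> is the whole vertex set, the evaluation is the constant 1
      without linear term, in accordance with the empty graph having no sink.\<close>
    proof (cases "verts ?H = {}")
      case True
      then have "unique_sink_orientations ?H = {}"
        by (auto simp: unique_sink_orientations_def sinks_def)
      then show ?thesis using chromatic_eval_no_verts[OF H True, of \<epsilon>] by simp
    next
      case False
      have "chromatic_eval \<epsilon> ?H = chromatic_eval (\<lambda>k. monom (signed_tail m k) 1) ?H"
        by (rule chromatic_eval_cong) (simp add: \<epsilon>_def)
      then show ?thesis
        using coeff_1_chromatic_eval_monom[OF H False] chromatic_coeff_one_part[OF H False]
        unfolding card by (simp add: mult.commute)
    qed
  qed
  finally show ?thesis .
qed

text \<open>Sending e_1 to 1 and every other e_k with k > 0 to 0 isolates this coefficient. That is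
  the alphabet of a single variable of value 1, and an edge prevents \<open>A\<close> from
  exhausting the vertices, so every remaining evaluation is 0.\<close>

lemma chromatic_coeff_all_ones:
  assumes "finite_multigraph G" "edges G \<noteq> {}"
  shows "chromatic_coeff G (replicate_mset (card (verts G)) 1) = 0"
proof -
  let ?n = "card (verts G)"
  define \<epsilon> :: "nat \<Rightarrow> int" where "\<epsilon> k = (if k = 0 then 1 else 0)" for k
  have \<epsilon>: "\<epsilon> k + 1 * \<epsilon> (k - 1) = (if k = 1 then 1 else 0)" if "0 < k" for k
    using that by (auto simp: \<epsilon>_def)
  have prod: "(\<Prod>k\<in>#p. if k = 1 then 1 else 0) = (if set_mset p \<subseteq> {1} then 1 else 0 :: int)"
    for p :: "nat multiset"
    by (induction p) auto
  have ones: "p \<in> int_partitions ?n \<and> set_mset p \<subseteq> {1} \<longleftrightarrow> p = replicate_mset ?n 1" for p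
  proof
    assume p: "p \<in> int_partitions ?n \<and> set_mset p \<subseteq> {1}"
    then have "p = replicate_mset (size p) 1" by (intro set_mset_subset_singletonD) simp
    moreover have "sum_mset p = size p" using conjunct2[OF p] by (induction p) auto
    ultimately show "p = replicate_mset ?n 1" using p by (simp add: int_partitions_def)
  qed (auto simp: int_partitions_def split: if_splits)
  have "chromatic_coeff G (replicate_mset ?n 1) = (\<Sum>p\<in>{replicate_mset ?n 1}. chromatic_coeff G p)"
    by simp
  also have "\<dots> = (\<Sum>p\<in>int_partitions ?n. chromatic_coeff G p * (if set_mset p \<subseteq> {1} then 1 else 0))"
    using ones by (intro sum.mono_neutral_cong_left finite_int_partitions) auto
  also have "\<dots> = chromatic_eval (\<lambda>k. if k = 1 then 1 else 0) G"
    unfolding chromatic_eval_def prod by simp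
  also have "\<dots> = chromatic_eval (\<lambda>k. \<epsilon> k + 1 * \<epsilon> (k - 1)) G"
    by (rule chromatic_eval_cong) (simp only: \<epsilon>)
  also have "\<dots> = (\<Sum>A\<in>stable_sets G. 1 ^ card A * chromatic_eval \<epsilon> (del_verts G A))"
    by (rule chromatic_eval_add_variable[OF assms(1)]) (simp add: \<epsilon>_def)
  also have "\<dots> = 0"
  proof (rule sum.neutral, rule ballI)
    fix A assume A: "A \<in> stable_sets G"
    obtain e where e: "e \<in> edges G" using assms(2) by blast
    then have "\<not> ends G e \<subseteq> A" using A by (simp add: stable_sets_def)
    moreover have "ends G e \<subseteq> verts G" using assms(1) e by (auto simp: finite_multigraph_def)
    ultimately have "verts (del_verts G A) \<noteq> {}" by auto
    then show "1 ^ card A * chromatic_eval \<epsilon> (del_verts G A) = 0"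
      using chromatic_eval_0[OF finite_multigraph_del_verts[OF assms(1)], of A \<epsilon>] by (simp add: \<epsilon>_def)
  qed
  finally show ?thesis .
qed

theorem corollary2p8:
  fixes G :: "('v, 'e) multigraph" and n m :: nat
  assumes "1 \<le> m" and "m \<le> n"
    and "finite_multigraph G" and "card (verts G) = n"
    and "\<nexists>v. isolated G v"
  shows "chromatic_coeff G ({#m#} + replicate_mset (n - m) 1) =
    (\<Sum>\<omega>\<in>unique_sink_orientations G. int ((card (sources G \<omega>) - 1) choose (n - m)))"
proof -
  let ?Z = "unique_sink_orientations G"
  have V: "verts G \<noteq> {}" using assms(1,2,4) by auto
  have Z: "?Z \<subseteq> acyclic_orientations G" by (auto simp: unique_sink_orientations_def)
  have sources: "sources G \<omega> \<noteq> {}" "finite (sources G \<omega>)" "card (sources G \<omega>) < n" if "\<omega> \<in> ?Z" for \<omega>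
  proof -
    show "sources G \<omega> \<noteq> {}" "finite (sources G \<omega>)"
      using sources_nonempty[OF assms(3) _ V] finite_sources[OF assms(3)] that Z by auto
    \<comment> \<open>The unique sink is not a source, so at least one vertex is missing from the
      sources.\<close>
    have "\<exists>!v. v \<in> sinks G \<omega>" using that by (simp add: unique_sink_orientations_def)
    then obtain v where "v \<in> sinks G \<omega>" by blast
    then have "v \<in> verts G" "v \<notin> sources G \<omega>"
      using sinks_not_sources[OF assms(3,5)] that Z by (auto simp: sinks_def)
    moreover have "sources G \<omega> \<subseteq> verts G" by (auto simp: sources_def)
    ultimately have "sources G \<omega> \<subset> verts G" by blast
    then show "card (sources G \<omega>) < n"
      using assms(3,4) by (metis finite_multigraph_def psubset_card_mono)
  qed
  show ?thesis
  proof (cases "m = 1")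
    case True
    \<comment> \<open>In this case the partition consists of \<open>n\<close> ones, and both sides
      turn out to be 0.\<close>
    have "edges G \<noteq> {}" using V assms(5) by (auto simp: isolated_def)
    moreover have "{#m#} + replicate_mset (n - m) 1 = replicate_mset n 1"
      using True assms(2) by (cases n) auto
    ultimately have "chromatic_coeff G ({#m#} + replicate_mset (n - m) 1) = 0"
      using chromatic_coeff_all_ones[OF assms(3)] assms(4) by simp
    \<comment> \<open>The strict bound \<open>card (sources G \<omega>) < n\<close> makes every
      binomial coefficient vanish.\<close>
    moreover have "card (sources G \<omega>) - 1 < n - m" if "\<omega> \<in> ?Z" for \<omega>
      using sources[OF that] True by (simp add: card_gt_0_iff diff_less_mono Suc_leI)
    ultimately show ?thesis by (simp add: binomial_eq_0)
  next
    case False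
    then have m: "2 \<le> m" "0 < m" using assms(1) by auto
    have "chromatic_coeff G ({#m#} + replicate_mset (n - m) 1) =
        (\<Sum>A\<in>stable_sets G. signed_tail m (n - card A) *
          int (card {\<omega> \<in> ?Z. A \<subseteq> sources G \<omega>}))"
      using chromatic_coeff_hook[OF assms(3) m(1)] assms(2,4)
      by (simp add: bij_betw_same_card[OF bij_betw_restrict_sources_unique_sink[OF assms(3,5)]])
    also have "\<dots> = (\<Sum>\<omega>\<in>?Z. \<Sum>A\<in>Pow (sources G \<omega>). signed_tail m (n - card A))"
      using sum_stable_sets_sources[OF assms(3) Z, of "\<lambda>i. signed_tail m (n - i)"] by simp
    also have "\<dots> = (\<Sum>\<omega>\<in>?Z. int ((card (sources G \<omega>) - 1) choose (n - m)))"
      using sources m(2) assms(2) by (intro sum.cong refl sum_Pow_signed_tail) (auto intro: less_imp_le)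
    finally show ?thesis .
  qed
qed

end
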